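(* Let $\mathscr{A}$ be a $C^{*}$-algebra, $\mathscr{B},\mathscr{C}$ Banach algebras, $\varphi:\mathscr{A}\to\mathscr{B}$ and $\psi:\mathscr{A}\to\mathscr{C}$ algebra homomorphisms, and $X$ a Banach $\mathscr{B}$-$\mathscr{C}$-bimodule. Then every bounded Jordan $(\varphi,\psi)$-derivation $\delta:\mathscr{A}\to X$ is a $(\varphi,\psi)$-derivation.
   Context: A Banach $\mathscr{B}$-$\mathscr{C}$-bimodule is a Banach space $X$ that is a left Banach $\mathscr{B}$-module and a right Banach $\mathscr{C}$-module with commuting actions and $\|b\cdot x\cdot c\|\le\|b\|\|x\|\|c\|$. A linear map $\delta:\mathscr{A}\to X$ is a Jordan $(\varphi,\psi)$-derivation if $\delta(a^{2})=\varphi(a)\cdot\delta(a)+\delta(a)\cdot\psi(a)$ for all $a$, and a $(\varphi,\psi)$-derivation if $\delta(ab)=\delta(a)\cdot\psi(b)+\varphi(a)\cdot\delta(b)$ for all $a,b$. *)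

theory Defs
  imports "HOL-Analysis.Analysis"
begin

class complex_vector = real_vector +
  fixes scaleC :: "complex \<Rightarrow> 'a \<Rightarrow> 'a"
  assumes scaleC_add_right: "scaleC a (x + y) = scaleC a x + scaleC a y"
    and scaleC_add_left: "scaleC (a + b) x = scaleC a x + scaleC b x"
    and scaleC_scaleC: "scaleC a (scaleC b x) = scaleC (a * b) x"
    and scaleC_one: "scaleC 1 x = x"
    and scaleR_scaleC: "scaleR r x = scaleC (complex_of_real r) x"

class complex_normed_vector = complex_vector + real_normed_vector +
  assumes norm_scaleC: "norm (scaleC a x) = cmod a * norm x"

text \<open>Complex normed algebras (not necessarily unital, submultiplicative norm,
  associative multiplication).  Banach algebra = complex normed algebra + complete.\<close>
class complex_normed_algebra = complex_normed_vector + real_normed_algebra +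
  assumes mult_scaleC_left: "scaleC a x * y = scaleC a (x * y)"
    and mult_scaleC_right: "x * scaleC a y = scaleC a (x * y)"

class cstar_algebra = complex_normed_algebra + banach +
  fixes invol :: "'a \<Rightarrow> 'a"
  assumes invol_invol: "invol (invol x) = x"
    and invol_add: "invol (x + y) = invol x + invol y"
    and invol_scaleC: "invol (scaleC a x) = scaleC (cnj a) (invol x)"
    and invol_mult: "invol (x * y) = invol y * invol x"
    and cstar_identity: "norm (invol x * x) = norm x ^ 2"

definition clinear :: "('a::complex_vector \<Rightarrow> 'b::complex_vector) \<Rightarrow> bool" where
  "clinear f \<longleftrightarrow> (\<forall>x y. f (x + y) = f x + f y) \<and> (\<forall>c x. f (scaleC c x) = scaleC c (f x))"

definition alg_hom :: "('a::complex_normed_algebra \<Rightarrow> 'b::complex_normed_algebra) \<Rightarrow> bool" where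
  "alg_hom f \<longleftrightarrow> clinear f \<and> (\<forall>a b. f (a * b) = f a * f b)"

definition bounded_map :: "('a::real_normed_vector \<Rightarrow> 'b::real_normed_vector) \<Rightarrow> bool" where
  "bounded_map f \<longleftrightarrow> (\<exists>K. \<forall>x. norm (f x) \<le> K * norm x)"

definition banach_bimodule ::
  "('b::complex_normed_algebra \<Rightarrow> 'x::{complex_normed_vector,banach} \<Rightarrow> 'x) \<Rightarrow>
   ('x \<Rightarrow> 'c::complex_normed_algebra \<Rightarrow> 'x) \<Rightarrow> bool" where
  "banach_bimodule lact ract \<longleftrightarrow>
     \<comment> \<open>left module\<close>
     (\<forall>b x y. lact b (x + y) = lact b x + lact b y) \<and>
     (\<forall>b b' x. lact (b + b') x = lact b x + lact b' x) \<and>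
     (\<forall>b b' x. lact (b * b') x = lact b (lact b' x)) \<and>
     (\<forall>a b x. lact (scaleC a b) x = scaleC a (lact b x)) \<and>
     (\<forall>a b x. lact b (scaleC a x) = scaleC a (lact b x)) \<and>
     (\<forall>b x. norm (lact b x) \<le> norm b * norm x) \<and>
     \<comment> \<open>right module\<close>
     (\<forall>c x y. ract (x + y) c = ract x c + ract y c) \<and>
     (\<forall>c c' x. ract x (c + c') = ract x c + ract x c') \<and>
     (\<forall>c c' x. ract x (c * c') = ract (ract x c) c') \<and>
     (\<forall>a c x. ract x (scaleC a c) = scaleC a (ract x c)) \<and>
     (\<forall>a c x. ract (scaleC a x) c = scaleC a (ract x c)) \<and>
     (\<forall>c x. norm (ract x c) \<le> norm x * norm c) \<and>
     \<comment> \<open>commuting actions and the bimodule norm bound\<close>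
     (\<forall>b x c. ract (lact b x) c = lact b (ract x c)) \<and>
     (\<forall>b x c. norm (lact b (ract x c)) \<le> norm b * norm x * norm c)"

definition jordan_phipsi_derivation where
  "jordan_phipsi_derivation \<phi> \<psi> lact ract \<delta> \<longleftrightarrow>
     clinear \<delta> \<and> (\<forall>a. \<delta> (a * a) = lact (\<phi> a) (\<delta> a) + ract (\<delta> a) (\<psi> a))"

definition phipsi_derivation where
  "phipsi_derivation \<phi> \<psi> lact ract \<delta> \<longleftrightarrow>
     clinear \<delta> \<and> (\<forall>a b. \<delta> (a * b) = ract (\<delta> a) (\<psi> b) + lact (\<phi> a) (\<delta> b))"

end

theory Submission
  imports Defs
begin

text \<open>
  After passing to the unitization, the defect \<open>\<Delta>(a, b) = \<delta>(ab) - a\<delta>(b) - \<delta>(a)b\<close> is an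
  alternating Hochschild cocycle with \<open>\<Delta>(a, b) x [a, b] = - [a, b] x \<Delta>(a, b)\<close>.
  As \<open>\<phi>\<close> and \<open>\<psi>\<close> may be discontinuous, so may be the module actions; but boundedness of \<open>\<delta>\<close>
  makes \<open>c \<mapsto> c\<Delta>(a, b) + \<Delta>(a, b)c\<close> bounded, and this makes the annihilator of \<open>\<Delta>(a, b)\<close> a closed
  ideal, because every self-adjoint element of a closed ideal is a product of two elements of the ideal.
  By polarization these annihilators contain all commutators, so \<open>\<Delta>\<close> factors through
  a commutative quotient, where \<open>D = \<Delta>(a, \<cdot>)\<close> is a derivation into a symmetric module.  If \<open>cD\<close> is
  bounded, then \<open>cD = 0\<close>, because \<open>D(u ^ n) = n u ^ (n - 1) D(u)\<close> for unitary \<open>u\<close>.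
  A gliding hump argument excludes infinite orthogonal sequences outside the closed ideal
  \<open>F = {c. cD = 0}\<close>, so if \<open>F\<close> were proper, some \<open>f \<notin> F\<close> could not be split further.
  Cutting \<open>f\<close> by the positive and negative parts of \<open>h - t\<close> shows \<open>f(h - t) \<in> F\<close> for
  some real \<open>t\<close>, whence \<open>f\<^sup>2D(h) = 0\<close> for all self-adjoint \<open>h\<close>, a contradiction.
\<close>

subsection \<open>Square roots of power bounded elements\<close>

text \<open>Taylor coefficients at \<open>0\<close> of the function
  \<open>sqrt (1 - z)\<close>.\<close>

definition sqrt_coeff :: "nat \<Rightarrow> real" where
  "sqrt_coeff n = (-1) ^ n * ((1/2) gchoose n)"

lemma sqrt_coeff_0: "sqrt_coeff 0 = 1"
  by (simp add: sqrt_coeff_def)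

text \<open>These numbers are, up to positive factors, the values
  \<open>- sqrt_coeff (Suc n)\<close>, and they are also the partial sums of
  \<open>sqrt_coeff\<close>.\<close>

lemma neg_half_gbinomial_nonneg: "0 \<le> (-1) ^ n * ((-1/2 :: real) gchoose n)"
proof -
  have "(-1/2 :: real) gchoose n = (-1) ^ n * (1/2 + of_nat n - 1 gchoose n)"
    using gbinomial_minus[of "1/2::real" n] by simp
  moreover have "0 \<le> (1/2 + of_nat n - 1 gchoose n :: real)"
    unfolding gbinomial_prod_rev by (intro divide_nonneg_nonneg prod_nonneg) auto
  ultimately show ?thesis by simp
qed

lemma sqrt_coeff_Suc_nonpos: "sqrt_coeff (Suc n) \<le> 0"
proof -
  have "real (Suc n) * sqrt_coeff (Suc n) = (-1) ^ Suc n * (real (Suc n) * ((1/2) gchoose Suc n))"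
    by (simp add: sqrt_coeff_def)
  also have "real (Suc n) * ((1/2) gchoose Suc n) = 1/2 * ((-1/2) gchoose n)"
    using gbinomial_absorption[of n "1/2::real"] by (simp add: field_simps)
  also have "(-1) ^ Suc n * (1/2 * ((-1/2 :: real) gchoose n)) = - (1/2) * ((-1) ^ n * ((-1/2) gchoose n))"
    by simp
  also have "\<dots> \<le> 0" using neg_half_gbinomial_nonneg[of n] by simp
  finally show ?thesis
    by (simp add: mult_le_0_iff)
qed

text \<open>Only the coefficient at \<open>0\<close> is positive, so the absolute values add up to
  \<open>2\<close> minus a partial sum of \<open>sqrt_coeff\<close>, and these partial sums are
  nonnegative.\<close>

lemma summable_abs_sqrt_coeff: "summable (\<lambda>n. \<bar>sqrt_coeff n\<bar>)"
proof (rule summableI_nonneg_bounded)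
  fix n
  have abs_eq: "\<bar>sqrt_coeff k\<bar> = (if k = 0 then 2 else 0) - sqrt_coeff k" for k
    using sqrt_coeff_Suc_nonpos[of "k - 1"] by (cases k) (auto simp: sqrt_coeff_0)
  show "(\<Sum>k<n. \<bar>sqrt_coeff k\<bar>) \<le> 2"
  proof (cases n)
    case (Suc m)
    have "(\<Sum>k\<le>m. sqrt_coeff k) = (-1) ^ m * ((-1/2) gchoose m)"
      using gbinomial_sum_lower_neg[of "1/2::real" m] by (simp add: sqrt_coeff_def mult.commute)
    then have "0 \<le> (\<Sum>k\<le>m. sqrt_coeff k)" using neg_half_gbinomial_nonneg[of m] by simp
    then show ?thesis unfolding abs_eq Suc lessThan_Suc_atMost
      by (simp add: sum_subtractf)
  qed auto
qed auto

text \<open>Meant for power bounded \<^term>\<open>y\<close>, where it is a square root of \<^term>\<open>1 - y\<close>.\<close>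

definition sqrt_compl :: "'a::{real_normed_algebra_1,banach} \<Rightarrow> 'a" where
  "sqrt_compl y = (\<Sum>n. sqrt_coeff n *\<^sub>R y ^ n)"

context
  fixes y :: "'a::{real_normed_algebra_1,banach}" and K :: real
  assumes power_bounded: "\<And>n. norm (y ^ n) \<le> K"
begin

lemma summable_norm_sqrt_compl: "summable (\<lambda>n. norm (sqrt_coeff n *\<^sub>R y ^ n))"
proof (rule summable_comparison_test)
  show "\<exists>N. \<forall>n\<ge>N. norm (norm (sqrt_coeff n *\<^sub>R y ^ n)) \<le> K * \<bar>sqrt_coeff n\<bar>"
    using mult_right_mono[OF power_bounded abs_ge_zero] by (auto simp: mult.commute)
  show "summable (\<lambda>n. K * \<bar>sqrt_coeff n\<bar>)"
    by (intro summable_mult summable_abs_sqrt_coeff)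
qed

lemma sqrt_compl_sums: "(\<lambda>n. sqrt_coeff n *\<^sub>R y ^ n) sums sqrt_compl y"
  unfolding sqrt_compl_def
  by (rule summable_sums[OF summable_norm_cancel[OF summable_norm_sqrt_compl]])

text \<open>Absolute convergence permits the Cauchy product. Vandermonde's convolution of exponent
  \<open>1/2\<close> with itself leaves the binomial coefficients of exponent \<open>1\<close>, that
  is, the series \<open>1 - y\<close>.\<close>

lemma sqrt_compl_square: "sqrt_compl y * sqrt_compl y = 1 - y"
proof -
  let ?a = "\<lambda>n. sqrt_coeff n *\<^sub>R y ^ n"
  have conv: "(\<Sum>i\<le>n. ?a i * ?a (n - i)) = (if n = 0 then 1 else if n = 1 then - y else 0)" for n
  proof -
    have "(\<Sum>i\<le>n. ?a i * ?a (n - i)) = (\<Sum>i\<le>n. sqrt_coeff i * sqrt_coeff (n - i)) *\<^sub>R y ^ n"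
      unfolding scaleR_sum_left by (rule sum.cong) (simp_all flip: power_add)
    also have "(\<Sum>i\<le>n. sqrt_coeff i * sqrt_coeff (n - i))
        = (-1) ^ n * (\<Sum>i=0..n. ((1/2) gchoose i) * ((1/2) gchoose (n - i)))"
      unfolding sum_distrib_left atMost_atLeast0
    proof (rule sum.cong)
      fix i assume "i \<in> {0..n}"
      then have "(-1::real) ^ n = (-1) ^ i * (-1) ^ (n - i)" by (simp flip: power_add)
      then show "sqrt_coeff i * sqrt_coeff (n - i) =
          (-1) ^ n * (((1/2) gchoose i) * ((1/2) gchoose (n - i)))"
        by (simp add: sqrt_coeff_def)
    qed simp
    also have "\<dots> = (-1) ^ n * (1 gchoose n)"
      unfolding gbinomial_Vandermonde by simp
    also have "(1::real) gchoose n = of_nat (1 choose n)"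
      using binomial_gbinomial[of 1 n, where 'a=real] by simp
    finally show ?thesis by (cases "n \<le> 1") (auto simp: binomial_eq_0 le_Suc_eq)
  qed
  have "(\<lambda>n. \<Sum>i\<le>n. ?a i * ?a (n - i)) sums (sqrt_compl y * sqrt_compl y)"
    unfolding sqrt_compl_def
    by (rule Cauchy_product_sums[OF summable_norm_sqrt_compl summable_norm_sqrt_compl])
  moreover have "(\<lambda>n. \<Sum>i\<le>n. ?a i * ?a (n - i)) sums (1 - y)"
    unfolding conv
    using sums_finite[of "{0,1}" "\<lambda>n. if n = 0 then 1 else if n = 1 then - y else 0"] by simp
  ultimately show ?thesis by (rule sums_unique2)
qed

text \<open>Serves to prove commutation, with \<open>f\<close> and \<open>g\<close> the right and
  left multiplication by an element that commutes with \<open>y\<close>.\<close>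

lemma sqrt_compl_bounded_linear_eq:
  assumes "bounded_linear f" "bounded_linear g" "\<And>n. f (y ^ n) = g (y ^ n)"
  shows "f (sqrt_compl y) = g (sqrt_compl y)"
proof -
  have "(\<lambda>n. f (sqrt_coeff n *\<^sub>R y ^ n)) sums f (sqrt_compl y)"
    by (rule bounded_linear.sums[OF assms(1) sqrt_compl_sums])
  moreover have "(\<lambda>n. g (sqrt_coeff n *\<^sub>R y ^ n)) sums g (sqrt_compl y)"
    by (rule bounded_linear.sums[OF assms(2) sqrt_compl_sums])
  moreover have "(\<lambda>n. f (sqrt_coeff n *\<^sub>R y ^ n)) = (\<lambda>n. g (sqrt_coeff n *\<^sub>R y ^ n))"
    using assms by (simp add: linear_cmul[OF bounded_linear.linear])
  ultimately show ?thesis by (simp add: sums_unique2)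
qed

end

text \<open>At the real number \<open>1\<close> the series is a square root of
  \<open>1 - 1\<close>.\<close>

lemma sqrt_coeff_sums_0: "sqrt_coeff sums 0"
proof -
  have b: "norm ((1::real) ^ n) \<le> 1" for n by simp
  from sqrt_compl_square[OF b] have "sqrt_compl (1::real) = 0" by simp
  with sqrt_compl_sums[OF b] show ?thesis by simp
qed

text \<open>The coefficients sum up to \<^term>\<open>0\<close>, so the series may be written in terms of \<open>y ^ n - 1\<close>.\<close>

lemma sqrt_compl_in_closed_subspace:
  assumes "\<And>n. norm (y ^ n) \<le> K" and "closed S" "subspace S" and S: "\<And>n. y ^ n - 1 \<in> S"
  shows "sqrt_compl y \<in> S"
proof -
  have "(\<lambda>n. sqrt_coeff n *\<^sub>R y ^ n - sqrt_coeff n *\<^sub>R 1) sums (sqrt_compl y - 0 *\<^sub>R 1)"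
    by (intro sums_diff sqrt_compl_sums[OF assms(1)] sums_scaleR_left sqrt_coeff_sums_0)
  then have "(\<lambda>N. \<Sum>n<N. sqrt_coeff n *\<^sub>R (y ^ n - 1)) \<longlonglongrightarrow> sqrt_compl y"
    by (simp add: sums_def scaleR_diff_right)
  moreover have "(\<Sum>n<N. sqrt_coeff n *\<^sub>R (y ^ n - 1)) \<in> S" for N
    using \<open>subspace S\<close> S by (intro subspace_sum subspace_scale)
  ultimately show ?thesis by (rule closed_sequentially[OF \<open>closed S\<close>, rotated])
qed

text \<open>Identifies the branch: by the real binomial series the root is the positive one on these
  scalars.\<close>

lemma sqrt_compl_of_real:
  assumes "0 < t" "t < 1"
  shows "sqrt_compl (1 - (of_real t :: 'a::{real_normed_algebra_1,banach})\<^sup>2) = of_real t"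
proof -
  let ?z = "t\<^sup>2 - 1"
  have "\<bar>?z\<bar> < 1" using assms by (simp add: abs_if power_less_one_iff power_le_one_iff)
  from gen_binomial_real[OF this, of "1/2"]
  moreover have minus_power: "?z ^ n = (-1) ^ n * (1 - t\<^sup>2) ^ n" for n
    by (simp flip: power_mult_distrib)
  ultimately have "(\<lambda>n. sqrt_coeff n * (1 - t\<^sup>2) ^ n) sums (t\<^sup>2 powr (1/2))"
    by (simp add: sqrt_coeff_def minus_power mult_ac)
  also have "t\<^sup>2 powr (1/2) = t" using assms by (simp add: powr_half_sqrt)
  finally have "(\<lambda>n. of_real (sqrt_coeff n * (1 - t\<^sup>2) ^ n) :: 'a) sums of_real t"
    by (rule sums_of_real)
  then show ?thesis
    unfolding sqrt_compl_def by (simp add: sums_iff scaleR_conv_of_real)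
qed

text \<open>The common bound \<open>K\<close> makes the series converge uniformly on
  \<open>S\<close> by the Weierstrass test.\<close>

lemma continuous_on_sqrt_compl:
  fixes g :: "'t::topological_space \<Rightarrow> 'a::{real_normed_algebra_1,banach}"
  assumes "continuous_on S g" and bound: "\<And>t n. t \<in> S \<Longrightarrow> norm (g t ^ n) \<le> K"
  shows "continuous_on S (\<lambda>t. sqrt_compl (g t))"
  unfolding sqrt_compl_def
proof (rule uniform_limit_theorem)
  show "\<forall>\<^sub>F n in sequentially. continuous_on S (\<lambda>t. \<Sum>i<n. sqrt_coeff i *\<^sub>R g t ^ i)"
    using assms(1) by (intro always_eventually allI continuous_intros)
  show "uniform_limit S (\<lambda>n t. \<Sum>i<n. sqrt_coeff i *\<^sub>R g t ^ i)
      (\<lambda>t. \<Sum>i. sqrt_coeff i *\<^sub>R g t ^ i) sequentially"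
  proof (rule Weierstrass_m_test)
    show "norm (sqrt_coeff n *\<^sub>R g t ^ n) \<le> K * \<bar>sqrt_coeff n\<bar>" if "t \<in> S" for n t
      using mult_right_mono[OF bound[OF that] abs_ge_zero] by (simp add: mult.commute)
    show "summable (\<lambda>n. K * \<bar>sqrt_coeff n\<bar>)"
      by (intro summable_mult summable_abs_sqrt_coeff)
  qed
qed simp

text \<open>Banach-Steinhaus by Baire category: the closed sets \<open>A n\<close> cover the space,
  so one of them contains a ball, on which all \<open>T i\<close> are bounded by
  \<open>n\<close>.\<close>

lemma uniform_boundedness:
  fixes T :: "'i \<Rightarrow> 'a::banach \<Rightarrow> 'b::real_normed_vector"
  assumes T: "\<And>i. i \<in> I \<Longrightarrow> bounded_linear (T i)"
    and pointwise: "\<And>a. \<exists>M. \<forall>i\<in>I. norm (T i a) \<le> M"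
  shows "\<exists>K. \<forall>i\<in>I. \<forall>a. norm (T i a) \<le> K * norm a"
proof -
  define A where "A n = {a. \<forall>i\<in>I. norm (T i a) \<le> real n}" for n
  have closedA: "closed (A n)" for n
  proof -
    have "A n = (\<Inter>i\<in>I. {a. norm (T i a) \<le> real n})" by (auto simp: A_def)
    moreover have "closed {a. norm (T i a) \<le> real n}" if "i \<in> I" for i
      using linear_continuous_on[OF T[OF that]]
      by (intro closed_Collect_le continuous_intros) auto
    ultimately show ?thesis by (simp add: closed_INT)
  qed
  have "a \<in> \<Union>(range A)" for a
  proof -
    obtain M where "\<forall>i\<in>I. norm (T i a) \<le> M" using pointwise by blast
    moreover obtain n where "M \<le> real n" using real_arch_simple by blast
    ultimately show ?thesis by (auto simp: A_def intro!: exI[of _ n] intro: order_trans)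
  qed
  then have "\<Union>(range A) = UNIV" by blast
  have "\<exists>n. interior (A n) \<noteq> {}"
  proof (rule ccontr)
    assume "\<not> ?thesis"
    then have empty: "interior (A n) = {}" for n by blast
    have "Met_TC.mtopology interior_of \<Union>(range A) = {}"
    proof (rule Met_TC.metric_Baire_category_alt)
      show "Met_TC.mcomplete TYPE('a)"
        using complete_UNIV by (auto simp: Met_TC.mcomplete_def complete_def)
      show "countable (range A)" by simp
      show "closedin Met_TC.mtopology S \<and> Met_TC.mtopology interior_of S = {}" if "S \<in> range A" for S
        using that closedA empty by auto
    qed
    then show False using \<open>\<Union>(range A) = UNIV\<close> by simp
  qed
  then obtain n x where "x \<in> interior (A n)" by blast
  then obtain e where "0 < e" and ball: "cball x e \<subseteq> A n"
    unfolding mem_interior_cball by blast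
  have "norm (T i a) \<le> (2 * real n / e) * norm a" if i: "i \<in> I" for i a
  proof (cases "a = 0")
    case True
    then show ?thesis by (simp add: linear_0[OF bounded_linear.linear[OF T[OF i]]])
  next
    case False
    let ?h = "(e / norm a) *\<^sub>R a"
    interpret Ti: bounded_linear "T i" by (rule T[OF i])
    have "x + ?h \<in> cball x e" "x \<in> cball x e" using \<open>0 < e\<close> False by (auto simp: dist_norm)
    then have "x + ?h \<in> A n" "x \<in> A n" using ball by blast+
    then have "norm (T i (x + ?h)) \<le> n" "norm (T i x) \<le> n"
      using i by (auto simp: A_def)
    moreover have "T i ?h = T i (x + ?h) - T i x" by (simp add: Ti.add)
    ultimately have "norm (T i ?h) \<le> 2 * real n"
      using norm_triangle_ineq4[of "T i (x + ?h)" "T i x"] by simp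
    moreover have "norm (T i ?h) = (e / norm a) * norm (T i a)"
      using \<open>0 < e\<close> by (simp add: Ti.scaleR)
    ultimately show ?thesis using \<open>0 < e\<close> False by (simp add: field_simps)
  qed
  then show ?thesis by blast
qed

subsection \<open>C*-algebras and their closed ideals\<close>

definition two_sided_ideal :: "'u::real_algebra_1 set \<Rightarrow> bool" where
  "two_sided_ideal P \<longleftrightarrow> subspace P \<and> (\<forall>x\<in>P. \<forall>y. x * y \<in> P \<and> y * x \<in> P)"

lemma two_sided_idealI:
  assumes "0 \<in> P" "\<And>x y. x \<in> P \<Longrightarrow> y \<in> P \<Longrightarrow> x + y \<in> P"
    and "\<And>x y. x \<in> P \<Longrightarrow> x * y \<in> P" "\<And>x y. x \<in> P \<Longrightarrow> y * x \<in> P"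
  shows "two_sided_ideal P"
  unfolding two_sided_ideal_def
proof (intro conjI subspaceI ballI allI)
  show "c *\<^sub>R x \<in> P" if "x \<in> P" for c x
    using assms(3)[OF that, of "c *\<^sub>R 1"] by simp
qed (use assms in auto)

context
  fixes P :: "'u::real_algebra_1 set"
  assumes P: "two_sided_ideal P"
begin

lemma ideal_subspace: "subspace P" using P by (simp add: two_sided_ideal_def)
lemma ideal_mult_right: "x \<in> P \<Longrightarrow> x * y \<in> P" using P by (simp add: two_sided_ideal_def)
lemma ideal_mult_left: "x \<in> P \<Longrightarrow> y * x \<in> P" using P by (simp add: two_sided_ideal_def)
lemma ideal_zero: "0 \<in> P" by (rule subspace_0[OF ideal_subspace])
lemma ideal_add: "x \<in> P \<Longrightarrow> y \<in> P \<Longrightarrow> x + y \<in> P" by (rule subspace_add[OF ideal_subspace])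
lemma ideal_diff: "x \<in> P \<Longrightarrow> y \<in> P \<Longrightarrow> x - y \<in> P" by (rule subspace_diff[OF ideal_subspace])
lemma ideal_scaleR: "x \<in> P \<Longrightarrow> c *\<^sub>R x \<in> P" by (rule subspace_scale[OF ideal_subspace])

lemma ideal_power_minus_one: "v - 1 \<in> P \<Longrightarrow> v ^ n - 1 \<in> P"
proof (induction n)
  case (Suc n)
  have "v ^ Suc n - 1 = v * (v ^ n - 1) + (v - 1)" by (simp add: algebra_simps)
  then show ?case
    by (simp only: ideal_add ideal_mult_left Suc)
qed (simp add: ideal_zero)

end

lemma two_sided_ideal_closure:
  fixes P :: "'u::real_normed_algebra_1 set"
  assumes P: "two_sided_ideal P"
  shows "two_sided_ideal (closure P)"
proof (rule two_sided_idealI)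
  fix x y assume "x \<in> closure P"
  then obtain s where s: "\<And>n. s n \<in> P" "s \<longlonglongrightarrow> x" by (auto simp: closure_sequential)
  show "x * y \<in> closure P" unfolding closure_sequential
    by (rule exI[of _ "\<lambda>n. s n * y"]) (auto intro!: tendsto_intros s ideal_mult_right[OF P])
  show "y * x \<in> closure P" unfolding closure_sequential
    by (rule exI[of _ "\<lambda>n. y * s n"]) (auto intro!: tendsto_intros s ideal_mult_left[OF P])
  show "x + y \<in> closure P" if y: "y \<in> closure P"
  proof -
    obtain t where t: "\<And>n. t n \<in> P" "t \<longlonglongrightarrow> y"
      using y by (auto simp: closure_sequential)
    show ?thesis unfolding closure_sequential
      by (rule exI[of _ "\<lambda>n. s n + t n"]) (auto intro!: tendsto_intros s t ideal_add[OF P])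
  qed
qed (use closure_subset ideal_zero[OF P] in blast)

lemma two_sided_ideal_Int:
  "two_sided_ideal P \<Longrightarrow> two_sided_ideal Q \<Longrightarrow> two_sided_ideal (P \<inter> Q)"
  unfolding two_sided_ideal_def by (auto simp: subspace_Int subspace_inter)

text \<open>The model is the unitization of a C*-algebra \<open>A\<close> with the sum norm, which fails the
  C*-identity but gives unitaries norm at most \<open>3\<close>; \<open>ii\<close> is the imaginary unit.\<close>

locale cstar_ideal =
  fixes star :: "'u::{real_normed_algebra_1,banach} \<Rightarrow> 'u" and A :: "'u set" and ii :: 'u
  assumes bounded_linear_star: "bounded_linear star"
    and star_mult: "star (x * y) = star y * star x"
    and star_star [simp]: "star (star x) = x"
    and closed_A: "closed A"
    and ideal_A: "two_sided_ideal A"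
    and star_A: "x \<in> A \<Longrightarrow> star x \<in> A"
    and commutator_A: "x * y - y * x \<in> A"
    and cstar: "x \<in> A \<Longrightarrow> norm (x * star x) = (norm x)\<^sup>2"
    and isometry_norm: "star u * u = 1 \<Longrightarrow> norm u \<le> 3"
    and ii_ii: "ii * ii = - 1"
    and ii_commute: "ii * x = x * ii"
    and star_ii: "star ii = - ii"
begin

lemma star_add: "star (x + y) = star x + star y"
  and star_diff: "star (x - y) = star x - star y"
  and star_minus: "star (- x) = - star x"
  and star_scaleR: "star (c *\<^sub>R x) = c *\<^sub>R star x"
  using bounded_linear_star
  by (simp_all add: linear_add linear_diff linear_neg linear_cmul bounded_linear.linear)

lemma star_one [simp]: "star 1 = 1"
proof -
  have "star (star 1 * 1) = star 1 * star (star 1)" by (rule star_mult)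
  then show ?thesis by simp
qed

section \<open>Unitaries built from self-adjoint elements\<close>

definition unitary :: "'u \<Rightarrow> bool" where
  "unitary u \<longleftrightarrow> star u * u = 1 \<and> u * star u = 1"

lemma unitary_norm: "unitary u \<Longrightarrow> norm u \<le> 3"
  by (simp add: unitary_def isometry_norm)

lemma unitary_one: "unitary 1"
  by (simp add: unitary_def)

lemma unitary_star: "unitary u \<Longrightarrow> unitary (star u)"
  by (simp add: unitary_def)

lemma unitary_mult:
  assumes "unitary u" "unitary v" shows "unitary (u * v)"
proof -
  have "star v * star u * (u * v) = star v * (star u * u) * v"
    "u * v * (star v * star u) = u * (v * star v) * star u" by (simp_all add: mult.assoc)
  with assms show ?thesis by (simp add: unitary_def star_mult)
qed

lemma unitary_power: "unitary u \<Longrightarrow> unitary (u ^ n)"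
  by (induction n) (auto simp: unitary_one unitary_mult)

lemma unitary_ii: "unitary ii"
  by (simp add: unitary_def star_ii ii_ii)

lemma mult_ii_ii: "ii * (ii * x) = - x"
  by (simp add: ii_ii flip: mult.assoc)

text \<open>With \<open>c = 1 + r\<close> the equation becomes \<open>r = F r\<close>, and
  \<open>F\<close> is a contraction on the closed set of self-adjoint \<open>r\<close> of norm at
  most \<open>1/2\<close> that commute with \<open>h\<close>. The result is the cosine of the angle
  whose sine is \<open>h\<close>.\<close>

lemma cosine_exists:
  assumes h: "star h = h" and "norm h \<le> 1/2"
  obtains c where "star c = c" "c * h = h * c" "c * c + h * h = 1"
proof -
  define S where "S = {r. norm r \<le> 1/2 \<and> star r = r \<and> r * h = h * r}"
  define F where "F r = - (1/2) *\<^sub>R (h * h + r * r)" for r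
  have cont: "continuous_on UNIV star"
    by (rule linear_continuous_on[OF bounded_linear_star])
  have "S = cball 0 (1/2) \<inter> ({r. star r = r} \<inter> {r. r * h = h * r})"
    by (auto simp: S_def)
  then have "closed S"
    by (auto intro!: closed_Int closed_Collect_eq continuous_intros cont)
  have "\<exists>!r\<in>S. F r = r"
  proof (rule Banach_fix[where c = "1/2"])
    show "complete S" using \<open>closed S\<close> by (simp add: complete_eq_closed)
    have "0 \<in> S" using star_scaleR[of 0 0] by (simp add: S_def)
    then show "S \<noteq> {}" by blast
    show "F ` S \<subseteq> S"
    proof (clarify)
      fix r assume "r \<in> S"
      then have r: "norm r \<le> 1/2" "star r = r" "r * h = h * r" by (auto simp: S_def)
      have "norm (h * h) \<le> (1/2) * (1/2)"
        by (rule norm_mult_ineq[THEN order_trans]) (intro mult_mono assms norm_ge_zero; simp)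
      moreover have "norm (r * r) \<le> (1/2) * (1/2)"
        by (rule norm_mult_ineq[THEN order_trans]) (intro mult_mono r norm_ge_zero; simp)
      ultimately have "norm (h * h + r * r) \<le> 1"
        using norm_triangle_ineq[of "h * h" "r * r"] by linarith
      moreover have "star (F r) = F r"
        using h r by (simp add: F_def star_add star_scaleR star_mult star_minus)
      moreover have "r * r * h = h * (r * r)"
        using r(3) by (metis mult.assoc)
      then have "F r * h = h * F r"
        by (simp add: F_def algebra_simps)
      ultimately show "F r \<in> S" by (simp add: S_def F_def)
    qed
    show "dist (F x) (F y) \<le> 1/2 * dist x y" if "x \<in> S" "y \<in> S" for x y
    proof -
      have "x * x - y * y = x * (x - y) + (x - y) * y" by (simp add: algebra_simps)
      moreover have "norm (x * (x - y)) \<le> 1/2 * norm (x - y)"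
        using that by (intro norm_mult_ineq[THEN order_trans] mult_right_mono) (auto simp: S_def)
      moreover have "norm ((x - y) * y) \<le> norm (x - y) * (1/2)"
        using that by (intro norm_mult_ineq[THEN order_trans] mult_left_mono) (auto simp: S_def)
      ultimately have "norm (x * x - y * y) \<le> norm (x - y)"
        using norm_triangle_ineq[of "x * (x - y)" "(x - y) * y"] by simp
      moreover have "F x - F y = - (1/2) *\<^sub>R (x * x - y * y)"
        by (simp add: F_def algebra_simps)
      ultimately show ?thesis by (simp add: dist_norm)
    qed
  qed auto
  then obtain r where r: "r \<in> S" "F r = r" by blast
  have "2 *\<^sub>R r = 2 *\<^sub>R F r" by (simp add: r)
  then have "2 *\<^sub>R r = - (h * h + r * r)" by (simp add: F_def)
  then have "(1 + r) * (1 + r) + h * h = 1"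
    by (simp add: algebra_simps scaleR_2)
  moreover have "(1 + r) * h = h * (1 + r)" "star (1 + r) = 1 + r"
    using r(1) by (simp_all add: S_def algebra_simps star_add)
  ultimately show ?thesis using that by blast
qed

text \<open>The unitary is \<open>c + ii * h\<close>, cosine plus \<open>ii\<close> times sine. The
  last clause serves to bound the powers of \<open>1 - h\<^sup>2\<close>.\<close>

lemma unitary_exists:
  assumes h: "star h = h" and "norm h \<le> 1/2"
  obtains u where "unitary u" "u * h = h * u" "u - star u = 2 *\<^sub>R (ii * h)"
    "((1/2) *\<^sub>R (u + star u))\<^sup>2 = 1 - h\<^sup>2"
proof -
  obtain c where c: "star c = c" "c * h = h * c" "c * c + h * h = 1"
    using cosine_exists[OF assms] by blast
  let ?u = "c + ii * h"
  have star_u: "star ?u = c - ii * h"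
    using h c by (simp add: star_add star_mult star_ii ii_commute[of h])
  have sq: "ii * h * (ii * h) = - (h * h)"
    by (metis ii_commute mult.assoc mult_ii_ii)
  have comm: "c * (ii * h) = ii * h * c"
    by (metis c(2) ii_commute mult.assoc)
  have "unitary ?u"
    proof -
    have "(c - ii * h) * ?u = c * c - ii * h * (ii * h)" "?u * (c - ii * h) = c * c - ii * h * (ii * h)"
      by (simp_all only: algebra_simps comm)
    then show ?thesis using c(3) by (simp add: unitary_def star_u sq)
  qed
  moreover have "?u * h = h * ?u"
    by (simp add: algebra_simps c(2)) (metis ii_commute mult.assoc)
  moreover have "?u - star ?u = 2 *\<^sub>R (ii * h)"
    by (simp add: star_u scaleR_2)
  moreover have "(1/2) *\<^sub>R (?u + star ?u) = c"
    by (simp add: star_u flip: scaleR_2)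
  then have "((1/2) *\<^sub>R (?u + star ?u))\<^sup>2 = 1 - h\<^sup>2"
    using c(3) by (simp add: power2_eq_square algebra_simps)
  ultimately show ?thesis using that by blast
qed

text \<open>The power is an average of words in \<open>u\<close> and \<open>star u\<close>, which
  are unitary and so have norm at most \<open>3\<close>. The factor \<open>z\<close> collects these
  words in the induction.\<close>

lemma norm_real_part_power_mult:
  assumes "unitary u" "unitary z"
  shows "norm (((1/2) *\<^sub>R (u + star u)) ^ n * z) \<le> 3"
  using assms(2)
proof (induction n arbitrary: z)
  case 0
  then show ?case by (simp add: unitary_norm)
next
  case (Suc n)
  let ?c = "(1/2) *\<^sub>R (u + star u)"
  have "?c ^ Suc n * z = (1/2) *\<^sub>R (?c ^ n * (u * z) + ?c ^ n * (star u * z))"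
    unfolding power_Suc2 by (simp add: algebra_simps)
  moreover have "norm (?c ^ n * (u * z)) \<le> 3" "norm (?c ^ n * (star u * z)) \<le> 3"
    by (intro Suc.IH unitary_mult unitary_star assms(1) Suc.prems)+
  ultimately show ?case
    using norm_triangle_ineq[of "?c ^ n * (u * z)" "?c ^ n * (star u * z)"] by simp
qed

lemma one_minus_square_power_bounded:
  assumes "star h = h" and "norm h \<le> 1/2"
  shows "norm ((1 - h\<^sup>2) ^ n) \<le> 3"
proof -
  obtain u where "unitary u" and "((1/2) *\<^sub>R (u + star u))\<^sup>2 = 1 - h\<^sup>2"
    using unitary_exists[OF assms] by blast
  then show ?thesis
    using norm_real_part_power_mult[OF \<open>unitary u\<close> unitary_one, of "2 * n"]
    by (simp add: power_mult)
qed

text \<open>Shows that \<open>u\<^sup>2 - 1\<close> lies in every ideal that contains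
  \<open>h\<close>.\<close>

lemma unitary_square_minus_one:
  assumes "unitary u" and "u * h = h * u" and "u - star u = 2 *\<^sub>R (ii * h)"
  shows "u\<^sup>2 - 1 = h * (2 *\<^sub>R (ii * u))"
proof -
  have "u\<^sup>2 - 1 = u * (u - star u)"
    using assms(1) by (simp add: unitary_def algebra_simps power2_eq_square)
  also have "\<dots> = h * (2 *\<^sub>R (ii * u))"
    unfolding assms(3) by (simp add: ii_commute assms(2) flip: mult.assoc)
  finally show ?thesis .
qed

text \<open>The root \<open>s\<close> of \<open>1 - u\<^sup>2\<close> lies in \<open>P\<close>,
  since the powers of \<open>u\<^sup>2\<close> equal \<open>1\<close> modulo \<open>P\<close>. As
  \<open>s * s = - (u * (u - star u))\<close>, multiplication by \<open>ii * star u\<close> turns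
  \<open>s * s\<close> into a positive multiple of \<open>h\<close>.\<close>

lemma selfadjoint_factorization:
  assumes P: "two_sided_ideal P" "closed P" and h: "h \<in> P" "star h = h"
  obtains p q where "p \<in> P" "q \<in> P" "h = p * q"
proof -
  \<comment> \<open>Scales \<open>h\<close> to norm at most \<open>1/2\<close>; the summand
    \<open>2\<close> keeps the denominator positive when \<open>h = 0\<close>.\<close>
  define r where "r = 1 / (2 * norm h + 2)"
  have "r > 0" by (simp add: r_def add_nonneg_pos)
  let ?k = "r *\<^sub>R h"
  have "norm ?k \<le> 1/2"
    using \<open>r > 0\<close> by (simp add: r_def field_simps)
  moreover have "star ?k = ?k" by (simp add: star_scaleR h)
  ultimately obtain u where u: "unitary u" "u * ?k = ?k * u" "u - star u = 2 *\<^sub>R (ii * ?k)"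
    using unitary_exists by blast
  define s where "s = sqrt_compl (u\<^sup>2)"
  have bound: "norm ((u\<^sup>2) ^ n) \<le> 3" for n
    using unitary_power[OF u(1), of "2 * n"] by (simp add: unitary_norm power_mult)
  have "u\<^sup>2 - 1 \<in> P"
    unfolding unitary_square_minus_one[OF u]
    by (intro ideal_mult_right[OF P(1)] ideal_scaleR[OF P(1)] h)
  then have "s \<in> P"
    unfolding s_def
    by (rule sqrt_compl_in_closed_subspace[OF bound P(2) ideal_subspace[OF P(1)]
        ideal_power_minus_one[OF P(1)]])
  have "s * s = 1 - u\<^sup>2" unfolding s_def by (rule sqrt_compl_square[OF bound])
  also have "\<dots> = - (u * (u - star u))"
    using u(1) by (simp add: unitary_def algebra_simps power2_eq_square)
  finally have "star u * (s * s) = - (star u * u * (u - star u))"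
    by (simp add: mult.assoc)
  then have "star u * (s * s) = - 2 *\<^sub>R (ii * ?k)"
    using u(1) by (simp add: u(3) unitary_def)
  then have "ii * (star u * (s * s)) = (2 * r) *\<^sub>R h"
    by (simp add: mult_ii_ii)
  then have "h = ((1 / (2 * r)) *\<^sub>R (ii * star u * s)) * s"
    using \<open>r > 0\<close> by (simp add: mult.assoc)
  then show ?thesis
    by (rule that[OF ideal_scaleR[OF P(1) ideal_mult_left[OF P(1) \<open>s \<in> P\<close>]] \<open>s \<in> P\<close>])
qed

text \<open>Approximate von Neumann regularity from a mean ergodic argument. Let
  \<open>k = w * star w\<close>, and let \<open>S\<close> be the mean of the first \<open>N\<close>
  powers of \<open>v\<close>. Then \<open>S * (v - 1)\<close> is of order \<open>1 / N\<close>,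
  hence so is \<open>S * k\<close>, and the C*-identity makes \<open>S * w\<close> small. As each
  \<open>1 - v ^ n\<close> is a right multiple of \<open>k\<close>, so is \<open>1 - S\<close>,
  which gives \<open>w - S * w\<close> the required form.\<close>

lemma cstar_regular_small:
  assumes w: "w \<in> A" "norm w \<le> 1/2" and "0 < \<epsilon>"
  shows "\<exists>q. norm (w - w * star w * q * w) < \<epsilon>"
proof -
  define k where "k = w * star w"
  have "norm k \<le> (1/2)\<^sup>2"
    unfolding k_def cstar[OF w(1)] using w(2) by (intro power_mono) auto
  then have "norm k \<le> 1/2" by (simp add: power2_eq_square)
  moreover have star_k: "star k = k" by (simp add: k_def star_mult)
  ultimately obtain u where u: "unitary u" "u * k = k * u" "u - star u = 2 *\<^sub>R (ii * k)"
    using unitary_exists by blast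
  define v where "v = u\<^sup>2"
  have v: "v - 1 = k * (2 *\<^sub>R (ii * u))"
    unfolding v_def by (rule unitary_square_minus_one[OF u])
  have uv: "unitary (v ^ n)" for n
    unfolding v_def by (intro unitary_power u)
  \<comment> \<open>Below, \<open>norm (S * k)\<close> is at most \<open>27 / N\<close> and
    \<open>norm (star S)\<close> at most \<open>3\<close>, so \<open>(norm (S * w))\<^sup>2\<close>
    is at most \<open>81 / N\<close>.\<close>
  obtain N :: nat where N: "81 / \<epsilon>\<^sup>2 < N" using reals_Archimedean2 by blast
  with \<open>0 < \<epsilon>\<close> have "0 < N" by (metis divide_pos_pos gr0I less_asym of_nat_0 zero_less_numeral zero_less_power)
  define S where "S = (1 / real N) *\<^sub>R (\<Sum>n<N. v ^ n)"
  have mean_bound: "norm ((1 / real N) *\<^sub>R (\<Sum>n<N. f n)) \<le> 3" if "\<And>n. norm (f n) \<le> 3"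
    for f :: "nat \<Rightarrow> 'u"
  proof -
    have "norm (\<Sum>n<N. f n) \<le> (\<Sum>n<N. 3)"
      by (intro norm_sum[THEN order_trans] sum_mono that)
    then show ?thesis using \<open>0 < N\<close> by (simp add: field_simps)
  qed
  have "star S = (1 / real N) *\<^sub>R (\<Sum>n<N. star (v ^ n))"
    unfolding S_def star_scaleR
    by (simp add: linear_sum[OF bounded_linear.linear[OF bounded_linear_star]])
  then have norm_star_S: "norm (star S) \<le> 3"
    using mean_bound[of "\<lambda>n. star (v ^ n)"] uv by (simp add: unitary_norm unitary_star)
  have "S * (v - 1) = (1 / real N) *\<^sub>R (\<Sum>n<N. v ^ Suc n - v ^ n)"
    by (simp add: S_def sum_distrib_right right_diff_distrib power_commutes sum_subtractf scaleR_diff_right)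
  also have "(\<Sum>n<N. v ^ Suc n - v ^ n) = v ^ N - 1"
    by (subst sum_lessThan_telescope) simp
  finally have Sv: "S * (v - 1) = (1 / real N) *\<^sub>R (v ^ N - 1)" .
  have "v - 1 = (u - star u) * u"
    using u(1) by (simp add: v_def unitary_def algebra_simps power2_eq_square)
  then have "(v - 1) * star u = 2 *\<^sub>R (ii * k)"
    using u(1,3) by (simp add: unitary_def mult.assoc)
  then have "(v - 1) * star u * ii = - 2 *\<^sub>R k"
    by (simp add: ii_commute[symmetric] mult_ii_ii)
  then have "k = - (1/2) *\<^sub>R ((v - 1) * star u * ii)" by simp
  then have "S * k = - (1/2) *\<^sub>R (S * (v - 1) * star u * ii)"
    by (metis mult.assoc mult_scaleR_right)
  then have "norm (S * k) = 1 / (2 * real N) * norm ((v ^ N - 1) * star u * ii)"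
    by (simp add: Sv)
  also have "norm ((v ^ N - 1) * star u * ii) \<le> 6 * 3 * 3"
  proof -
    have "norm (v ^ N - 1) \<le> 6"
      using norm_triangle_ineq4[of "v ^ N" 1] unitary_norm[OF uv[of N]] by simp
    moreover have "norm (star u) \<le> 3" "norm ii \<le> 3"
      using u unitary_ii by (simp_all add: unitary_norm unitary_star)
    ultimately show ?thesis
      by (intro norm_mult_ineq[THEN order_trans] mult_mono) auto
  qed
  finally have norm_Sk: "norm (S * k) \<le> 27 / real N"
    using \<open>0 < N\<close> by (simp add: field_simps)
  have "S * w \<in> A" by (rule ideal_mult_left[OF ideal_A w(1)])
  then have "(norm (S * w))\<^sup>2 = norm (S * k * star S)"
    by (simp add: k_def star_mult mult.assoc flip: cstar)
  also have "\<dots> \<le> 27 / real N * 3"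
    by (intro norm_mult_ineq[THEN order_trans] mult_mono norm_Sk norm_star_S) auto
  also have "\<dots> < \<epsilon>\<^sup>2"
    using N \<open>0 < N\<close> \<open>0 < \<epsilon>\<close> by (simp add: field_simps)
  finally have "norm (S * w) < \<epsilon>"
    using \<open>0 < \<epsilon>\<close> by (simp add: power_less_imp_less_base)
  moreover have "\<exists>Q. 1 - S = k * Q"
  proof -
    have "\<exists>q. 1 - v ^ n = k * q" for n
    proof (induction n)
      case (Suc n)
      then obtain q where "1 - v ^ n = k * q" by blast
      then have "1 - v ^ Suc n = k * q - (v - 1) * v ^ n"
        by (simp add: algebra_simps)
      then have "1 - v ^ Suc n = k * (q - 2 *\<^sub>R (ii * u) * v ^ n)"
        unfolding v by (simp add: algebra_simps)
      then show ?case by blast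
    qed (auto intro: exI[of _ 0])
    then obtain q where q: "\<And>n. 1 - v ^ n = k * q n" by metis
    have "1 - S = (1 / real N) *\<^sub>R (\<Sum>n<N. 1 - v ^ n)"
    proof -
      have "(\<Sum>n<N. 1 :: 'u) = real N *\<^sub>R 1" by (simp add: scaleR_conv_of_real)
      then show ?thesis
        using \<open>0 < N\<close> by (simp add: S_def sum_subtractf scaleR_diff_right del: sum_constant)
    qed
    also have "\<dots> = k * ((1 / real N) *\<^sub>R (\<Sum>n<N. q n))"
      by (simp add: q sum_distrib_left)
    finally show ?thesis by blast
  qed
  then obtain Q where "1 - S = k * Q" by blast
  then have "S = 1 - k * Q" by (simp add: algebra_simps)
  ultimately have "norm ((1 - k * Q) * w) < \<epsilon>" by simp
  then show ?thesis by (intro exI[of _ Q]) (simp add: k_def algebra_simps)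
qed

lemma cstar_regular:
  assumes w: "w \<in> A" and "0 < \<epsilon>"
  shows "\<exists>q. norm (w - w * star w * q * w) < \<epsilon>"
proof (cases "w = 0")
  case False
  define r where "r = 1 / (2 * norm w)"
  have "r > 0" using False by (simp add: r_def)
  have "r *\<^sub>R w \<in> A" "norm (r *\<^sub>R w) \<le> 1/2"
    using w False by (auto simp: ideal_scaleR[OF ideal_A] r_def)
  from cstar_regular_small[OF this, of "r * \<epsilon>"] \<open>r > 0\<close> \<open>0 < \<epsilon>\<close>
  obtain q where "norm (r *\<^sub>R w - r *\<^sub>R w * star (r *\<^sub>R w) * q * r *\<^sub>R w) < r * \<epsilon>" by auto
  moreover have "r *\<^sub>R w - r *\<^sub>R w * star (r *\<^sub>R w) * q * r *\<^sub>R w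
      = r *\<^sub>R (w - w * star w * (r\<^sup>2 *\<^sub>R q) * w)"
    by (simp add: star_scaleR algebra_simps power2_eq_square)
  ultimately have "norm (w - w * star w * (r\<^sup>2 *\<^sub>R q) * w) < \<epsilon>"
    using \<open>r > 0\<close> by simp
  then show ?thesis by blast
qed (use \<open>0 < \<epsilon>\<close> in auto)

text \<open>The approximants of \<open>w\<close> from \<open>cstar_regular\<close> lie in
  \<open>P\<close>, by the case \<open>x = star w * q\<close>. This acts as a semiprimeness
  criterion.\<close>

lemma mem_closed_if_regular:
  assumes "closed P" "w \<in> A" "\<And>x. w * x * w \<in> P"
  shows "w \<in> P"
proof -
  have "w \<in> closure P"
    unfolding closure_approachable
  proof (intro allI impI)
    fix \<epsilon> :: real assume "0 < \<epsilon>"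
    then obtain q where "norm (w - w * star w * q * w) < \<epsilon>"
      using cstar_regular[OF \<open>w \<in> A\<close>] by blast
    then show "\<exists>y\<in>P. dist y w < \<epsilon>"
      using assms(3)[of "star w * q"]
      by (intro bexI[of _ "w * star w * q * w"]) (auto simp: dist_norm norm_minus_commute mult.assoc)
  qed
  then show ?thesis using \<open>closed P\<close> by simp
qed

text \<open>The approximants \<open>star w * w * q * star w\<close> of \<open>star w\<close> contain
  the factor \<open>w\<close>.\<close>

lemma star_mem_closed_ideal:
  assumes P: "two_sided_ideal P" "closed P" and w: "w \<in> P" "w \<in> A"
  shows "star w \<in> P"
proof -
  have "star w \<in> closure P"
    unfolding closure_approachable
  proof (intro allI impI)
    fix \<epsilon> :: real assume "0 < \<epsilon>"
    then obtain q where "norm (star w - star w * star (star w) * q * star w) < \<epsilon>"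
      using cstar_regular[OF star_A[OF w(2)]] by blast
    moreover have "star w * star (star w) * q * star w \<in> P"
      using w(1) by (simp add: ideal_mult_left[OF P(1)] ideal_mult_right[OF P(1)])
    ultimately show "\<exists>y\<in>P. dist y (star w) < \<epsilon>"
      unfolding dist_norm by (metis norm_minus_commute)
  qed
  then show ?thesis using P(2) by simp
qed

lemma selfadjoint_decomposition:
  obtains h k where "star h = h" "star k = k" "w = h + ii * k"
    "\<And>P. two_sided_ideal P \<Longrightarrow> w \<in> P \<Longrightarrow> star w \<in> P \<Longrightarrow> h \<in> P \<and> k \<in> P"
proof -
  let ?h = "(1/2) *\<^sub>R (w + star w)" and ?k = "- (1/2) *\<^sub>R (ii * (w - star w))"
  have "star ?h = ?h" "star ?k = ?k"
    by (simp_all add: star_scaleR star_add star_diff star_mult star_ii star_minus ii_commute algebra_simps)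
  moreover have "w = ?h + ii * ?k"
    by (simp add: mult_ii_ii algebra_simps flip: scaleR_2)
  moreover have "?h \<in> P \<and> ?k \<in> P" if "two_sided_ideal P" "w \<in> P" "star w \<in> P" for P
    using that by (intro conjI ideal_scaleR ideal_mult_left ideal_add ideal_diff)
  ultimately show ?thesis using that by blast
qed

text \<open>By \<open>selfadjoint_factorization\<close> the real and imaginary parts of elements of
  \<open>P\<close> are products of two elements of \<open>P\<close>. This replaces continuity
  arguments: it will be applied to sets \<open>Q\<close> that are not known to be closed.\<close>

lemma closed_ideal_subset_if_products:
  assumes P: "two_sided_ideal P" "closed P" "P \<subseteq> A"
    and prod: "\<And>p q. p \<in> P \<Longrightarrow> q \<in> P \<Longrightarrow> p * q \<in> Q"
    and add: "\<And>x y. x \<in> Q \<Longrightarrow> y \<in> Q \<Longrightarrow> x + y \<in> Q"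
    and mult_ii: "\<And>x. x \<in> Q \<Longrightarrow> ii * x \<in> Q"
  shows "P \<subseteq> Q"
proof
  fix w assume "w \<in> P"
  then have "star w \<in> P" using star_mem_closed_ideal[OF P(1,2)] P(3) by blast
  have *: "x \<in> Q" if "x \<in> P" "star x = x" for x
    using selfadjoint_factorization[OF P(1,2) that] prod by metis
  obtain h k where "star h = h" "star k = k" "w = h + ii * k" "h \<in> P" "k \<in> P"
    using selfadjoint_decomposition[of w] P(1) \<open>w \<in> P\<close> \<open>star w \<in> P\<close> by metis
  then show "w \<in> Q" by (simp add: add mult_ii *)
qed

text \<open>The absolute value of a small self-adjoint \<open>h\<close>, as a root of
  \<open>h\<^sup>2 = 1 - (1 - h\<^sup>2)\<close>.\<close>

definition cabs :: "'u \<Rightarrow> 'u" where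
  "cabs h = sqrt_compl (1 - h\<^sup>2)"

context
  fixes h :: 'u
  assumes h: "star h = h" "norm h \<le> 1/2"
begin

lemma cabs_square: "cabs h * cabs h = h\<^sup>2"
  unfolding cabs_def using sqrt_compl_square[OF one_minus_square_power_bounded[OF h]] by simp

lemma cabs_commute: "cabs h * h = h * cabs h"
  unfolding cabs_def
proof (rule sqrt_compl_bounded_linear_eq[OF one_minus_square_power_bounded[OF h]])
  have "(1 - h\<^sup>2) * h = h * (1 - h\<^sup>2)"
    by (simp add: algebra_simps power2_eq_square)
  then show "(1 - h\<^sup>2) ^ n * h = h * (1 - h\<^sup>2) ^ n" for n
    by (rule power_commuting_commutes)
qed (simp_all add: bounded_linear_mult_left bounded_linear_mult_right)

end

lemma cabs_minus: "cabs (- h) = cabs h"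
  by (simp add: cabs_def)

lemma continuous_on_cabs: "continuous_on {h. star h = h \<and> norm h \<le> 1/2} cabs"
  unfolding cabs_def
  by (rule continuous_on_sqrt_compl[where K = 3])
    (auto intro!: continuous_intros one_minus_square_power_bounded)

lemma star_of_real: "star (of_real t) = of_real t"
  unfolding of_real_def star_scaleR by simp

text \<open>Near a positive scalar, \<open>cabs g + g\<close> is invertible while it annihilates \<open>cabs g - g\<close>.\<close>

lemma cabs_near_quarter:
  obtains \<rho> where "0 < \<rho>" "\<rho> \<le> 1/4"
    "\<And>h. star h = h \<Longrightarrow> norm h < \<rho> \<Longrightarrow> cabs (of_real (1/4) + h) = of_real (1/4) + h"
proof -
  let ?t = "of_real (1/4) :: 'u"
  have cabs_t: "cabs ?t = ?t"
    unfolding cabs_def by (rule sqrt_compl_of_real) auto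
  have "?t \<in> {h. star h = h \<and> norm h \<le> 1/2}"
    using star_of_real[of "1/4"] norm_of_real[of "1/4", where 'a='u] by simp
  from continuous_on_cabs[unfolded continuous_on_iff, rule_format, OF this, of "1/4"]
  obtain d where d: "0 < d"
    "\<And>x. star x = x \<Longrightarrow> norm x \<le> 1/2 \<Longrightarrow> dist x ?t < d \<Longrightarrow> dist (cabs x) ?t < 1/4"
    unfolding cabs_t by auto
  \<comment> \<open>The bound \<open>d\<close> keeps \<open>cabs ?g\<close> within
    \<open>1/4\<close> of \<open>?t\<close>; the bound \<open>1/4\<close> ensures
    \<open>norm ?g \<le> 1/2\<close> and, for the error \<open>e\<close> below,
    \<open>norm e < 1/2\<close>.\<close>
  define \<rho> where "\<rho> = min d (1/4)"
  have "cabs (?t + h) = ?t + h" if h: "star h = h" "norm h < \<rho>" for h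
  proof -
    let ?g = "?t + h"
    have g: "star ?g = ?g" "norm ?g \<le> 1/2"
      using norm_triangle_ineq[of ?t h] h norm_of_real[of "1/4", where 'a='u]
      by (auto simp: star_add star_of_real \<rho>_def)
    have "dist ?g ?t < d" using h by (simp add: dist_norm \<rho>_def)
    then have near: "norm (cabs ?g - ?t) < 1/4" using d(2)[OF g] by (simp add: dist_norm)
    define x where "x = cabs ?g - ?g"
    define e where "e = (cabs ?g - ?t) + h"
    have "norm e < 1/2"
      using norm_triangle_ineq[of "cabs ?g - ?t" h] near h by (simp add: e_def \<rho>_def)
    have "x * (cabs ?g + ?g) = 0"
      using cabs_square[OF g] cabs_commute[OF g]
      by (simp add: x_def power2_eq_square algebra_simps)
    moreover have "cabs ?g + ?g = of_real (1/2) + e"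
    proof -
      have "?t + ?t = of_real (1/2)" unfolding of_real_add[symmetric] by simp
      then show ?thesis by (simp add: e_def algebra_simps)
    qed
    ultimately have "x * (of_real (1/2) + e) = 0" by simp
    then have "(1/2) *\<^sub>R x = - (x * e)"
      unfolding distrib_left of_real_def by (simp add: add_eq_0_iff2)
    then have "norm x / 2 = norm (x * e)"
      by (metis norm_minus_cancel norm_scaleR abs_divide abs_one abs_numeral mult_1 times_divide_eq_left)
    then have "norm x / 2 \<le> norm x * norm e" using norm_mult_ineq[of x e] by simp
    then have "x = 0" using \<open>norm e < 1/2\<close>
      by (smt (verit) mult_less_cancel_left_pos norm_ge_zero norm_eq_zero divide_inverse inverse_eq_divide)
    then show ?thesis by (simp add: x_def)
  qed
  with d(1) show ?thesis using that[of \<rho>] by (auto simp: \<rho>_def)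
qed

end

subsection \<open>Jordan derivations into bimodules\<close>

lemma eq_minus_self_imp_zero: "x = - x \<Longrightarrow> x = 0" for x :: "'a::real_vector"
  using scaleR_2[of x] by (metis add.right_inverse scaleR_eq_0_iff zero_neq_numeral)

locale normed_left_module =
  fixes lm :: "'u::real_normed_algebra_1 \<Rightarrow> 'x::real_normed_vector \<Rightarrow> 'x"  (infixr "\<rhd>" 68)
  assumes lm_add_left: "(a + b) \<rhd> x = a \<rhd> x + b \<rhd> x"
    and lm_scaleR_left: "(c *\<^sub>R a) \<rhd> x = c *\<^sub>R (a \<rhd> x)"
    and lm_mult: "a \<rhd> b \<rhd> x = (a * b) \<rhd> x"
    and lm_one [simp]: "1 \<rhd> x = x"
    and bounded_linear_lm: "bounded_linear (\<lambda>x. a \<rhd> x)"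
begin

lemma lm_add_right: "a \<rhd> (x + y) = a \<rhd> x + a \<rhd> y"
  and lm_diff_right: "a \<rhd> (x - y) = a \<rhd> x - a \<rhd> y"
  and lm_minus_right: "a \<rhd> (- x) = - (a \<rhd> x)"
  and lm_zero_right [simp]: "a \<rhd> 0 = 0"
  and lm_scaleR_right: "a \<rhd> (c *\<^sub>R x) = c *\<^sub>R (a \<rhd> x)"
  using bounded_linear_lm[of a]
  by (simp_all add: linear_add linear_diff linear_neg linear_cmul linear_0 bounded_linear.linear)

lemma lm_minus_left: "(- a) \<rhd> x = - (a \<rhd> x)"
  using lm_scaleR_left[of "-1" a x] by simp

lemma lm_diff_left: "(a - b) \<rhd> x = a \<rhd> x - b \<rhd> x"
  using lm_add_left[of a "- b" x] by (simp add: lm_minus_left)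

lemma lm_zero_left [simp]: "0 \<rhd> x = 0"
  using lm_scaleR_left[of 0 0 x] by simp

lemmas lm_simps = lm_add_left lm_scaleR_left lm_mult lm_add_right lm_diff_right lm_minus_right
  lm_scaleR_right lm_minus_left lm_diff_left

end

locale jordan_derivation = cstar_ideal star A ii + normed_left_module lm
  for star :: "'u::{real_normed_algebra_1,banach} \<Rightarrow> 'u" and A ii
    and lm :: "'u \<Rightarrow> 'x::real_normed_vector \<Rightarrow> 'x"  (infixr "\<rhd>" 68) +
  fixes rm :: "'x \<Rightarrow> 'u \<Rightarrow> 'x"  (infixl "\<lhd>" 68) and \<delta> :: "'u \<Rightarrow> 'x"
  assumes rm_add_right: "x \<lhd> (a + b) = x \<lhd> a + x \<lhd> b"
    and rm_scaleR_right: "x \<lhd> (c *\<^sub>R a) = c *\<^sub>R (x \<lhd> a)"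
    and rm_mult: "(x \<lhd> a) \<lhd> b = x \<lhd> (a * b)"
    and rm_one [simp]: "x \<lhd> 1 = x"
    and bounded_linear_rm: "bounded_linear (\<lambda>x. x \<lhd> a)"
    and lm_rm: "(a \<rhd> x) \<lhd> b = a \<rhd> (x \<lhd> b)"
    and lm_ii: "ii \<rhd> x = x \<lhd> ii"
    and bounded_linear_\<delta>: "bounded_linear \<delta>"
    and jordan: "\<delta> (a * a) = a \<rhd> \<delta> a + \<delta> a \<lhd> a"
begin

lemma rm_add_left: "(x + y) \<lhd> a = x \<lhd> a + y \<lhd> a"
  and rm_diff_left: "(x - y) \<lhd> a = x \<lhd> a - y \<lhd> a"
  and rm_minus_left: "(- x) \<lhd> a = - (x \<lhd> a)"
  and rm_zero_left [simp]: "0 \<lhd> a = 0"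
  and rm_scaleR_left: "(c *\<^sub>R x) \<lhd> a = c *\<^sub>R (x \<lhd> a)"
proof -
  interpret right: bounded_linear "\<lambda>x. x \<lhd> a" by (rule bounded_linear_rm)
  show "(x + y) \<lhd> a = x \<lhd> a + y \<lhd> a" "(x - y) \<lhd> a = x \<lhd> a - y \<lhd> a"
    "(- x) \<lhd> a = - (x \<lhd> a)" "0 \<lhd> a = 0" "(c *\<^sub>R x) \<lhd> a = c *\<^sub>R (x \<lhd> a)"
    by (rule right.add right.diff right.neg right.zero right.scaleR)+
qed

lemma rm_minus_right: "x \<lhd> (- a) = - (x \<lhd> a)"
  using rm_scaleR_right[of x "-1" a] by simp

lemma rm_diff_right: "x \<lhd> (a - b) = x \<lhd> a - x \<lhd> b"
  using rm_add_right[of x a "- b"] by (simp add: rm_minus_right)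

lemma rm_zero_right [simp]: "x \<lhd> 0 = 0"
  using rm_scaleR_right[of x 0 0] by simp

lemma \<delta>_add: "\<delta> (a + b) = \<delta> a + \<delta> b"
  and \<delta>_diff: "\<delta> (a - b) = \<delta> a - \<delta> b"
  and \<delta>_minus: "\<delta> (- a) = - \<delta> a"
  and \<delta>_scaleR: "\<delta> (c *\<^sub>R a) = c *\<^sub>R \<delta> a"
  using bounded_linear_\<delta>
  by (simp_all add: linear_add linear_diff linear_neg linear_cmul bounded_linear.linear)

lemmas bimodule_simps = lm_simps rm_add_right rm_scaleR_right rm_mult lm_rm rm_add_left
  rm_diff_left rm_minus_left rm_scaleR_left rm_minus_right rm_diff_right
  \<delta>_add \<delta>_diff \<delta>_minus \<delta>_scaleR

section \<open>Jordan identities and the defect cocycle\<close>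

lemma jordan_product: "\<delta> (a * b) + \<delta> (b * a) = a \<rhd> \<delta> b + b \<rhd> \<delta> a + \<delta> a \<lhd> b + \<delta> b \<lhd> a"
  using jordan[of "a + b"] jordan[of a] jordan[of b]
  by (simp add: bimodule_simps algebra_simps)

lemma jordan_swap: "\<delta> (b * a) = a \<rhd> \<delta> b + b \<rhd> \<delta> a + \<delta> a \<lhd> b + \<delta> b \<lhd> a - \<delta> (a * b)"
  using jordan_product[of a b] by (simp add: algebra_simps)

text \<open>Twice \<open>a * b * a\<close> is the Jordan product of \<open>a\<close> with
  \<open>a * b + b * a\<close> minus that of \<open>a * a\<close> with \<open>b\<close>.\<close>

lemma jordan_triple:
  "\<delta> (a * b * a) = (a * b) \<rhd> \<delta> a + a \<rhd> (\<delta> b \<lhd> a) + \<delta> a \<lhd> (b * a)"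
proof -
  have ab: "\<delta> (b * a) = a \<rhd> \<delta> b + b \<rhd> \<delta> a + \<delta> a \<lhd> b + \<delta> b \<lhd> a - \<delta> (a * b)"
    by (rule jordan_swap)
  have "2 *\<^sub>R \<delta> (a * b * a)
      = (\<delta> (a * (a * b + b * a)) + \<delta> ((a * b + b * a) * a)) - (\<delta> (a * a * b) + \<delta> (b * (a * a)))"
    by (simp add: algebra_simps \<delta>_add scaleR_2)
  also have "\<dots> = 2 *\<^sub>R ((a * b) \<rhd> \<delta> a + a \<rhd> (\<delta> b \<lhd> a) + \<delta> a \<lhd> (b * a))"
    unfolding jordan_product by (simp add: bimodule_simps jordan ab algebra_simps scaleR_2)
  finally show ?thesis by simp
qed

lemma jordan_triple_product:
  "\<delta> (a * b * c) + \<delta> (c * b * a) =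
    (a * b) \<rhd> \<delta> c + (c * b) \<rhd> \<delta> a + a \<rhd> (\<delta> b \<lhd> c) + c \<rhd> (\<delta> b \<lhd> a) + \<delta> a \<lhd> (b * c) + \<delta> c \<lhd> (b * a)"
  using jordan_triple[of "a + c" b] jordan_triple[of a b] jordan_triple[of c b]
  by (simp add: bimodule_simps algebra_simps)

definition defect :: "'u \<Rightarrow> 'u \<Rightarrow> 'x" where
  "defect a b = \<delta> (a * b) - a \<rhd> \<delta> b - \<delta> a \<lhd> b"

lemma defect_swap: "defect b a = - defect a b"
  using jordan_product[of a b] by (simp add: defect_def algebra_simps)

lemma defect_add_left: "defect (a + a') b = defect a b + defect a' b"
  and defect_add_right: "defect a (b + b') = defect a b + defect a b'"
  and defect_diff_right: "defect a (b - b') = defect a b - defect a b'"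
  and defect_scaleR_right: "defect a (c *\<^sub>R b) = c *\<^sub>R defect a b"
  by (simp_all add: defect_def bimodule_simps algebra_simps)

text \<open>Up to sign \<open>defect\<close> is the Hochschild coboundary of
  \<open>\<delta>\<close>, and coboundaries are cocycles.\<close>

lemma defect_cocycle:
  "a \<rhd> defect b c - defect (a * b) c + defect a (b * c) - defect a b \<lhd> c = 0"
  by (simp add: defect_def bimodule_simps algebra_simps)

text \<open>The first two terms measure how far \<open>\<delta> (a * b * c)\<close> is from the
  derivation rule; by \<open>jordan_triple_product\<close> this deviation is cancelled by the one
  for \<open>c * b * a\<close>. The next lemma brackets the products the other way.\<close>

lemma defect_triple_right:
  "defect a b \<lhd> c + defect (a * b) c + defect c b \<lhd> a + defect (c * b) a = 0"
  using jordan_triple_product[of a b c]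
  by (simp add: defect_def bimodule_simps algebra_simps)

lemma defect_triple_left:
  "a \<rhd> defect b c + defect a (b * c) + c \<rhd> defect b a + defect c (b * a) = 0"
  using jordan_triple_product[of a b c]
  by (simp add: defect_def bimodule_simps algebra_simps)

text \<open>Since \<open>ii\<close> acts alike from both sides, the Jordan identity at
  \<open>ii\<close> gives \<open>2 *\<^sub>R (ii \<rhd> \<delta> ii) = - \<delta> 1 = 0\<close>.
  This is the first step to complex linearity of \<open>\<delta>\<close>.\<close>

lemma \<delta>_ii: "\<delta> ii = 0"
proof -
  have "\<delta> 1 = 0" using jordan[of 1] by simp
  then have "2 *\<^sub>R (ii \<rhd> \<delta> ii) = 0"
    using jordan[of ii] by (simp add: ii_ii \<delta>_minus lm_ii scaleR_2)
  then have "ii \<rhd> ii \<rhd> \<delta> ii = 0" by simp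
  then show ?thesis by (simp add: lm_mult ii_ii lm_minus_left)
qed

lemma \<delta>_ii_mult: "\<delta> (ii * a) = ii \<rhd> \<delta> a"
proof -
  have "2 *\<^sub>R \<delta> (ii * a) = 2 *\<^sub>R (ii \<rhd> \<delta> a)"
    using jordan_product[of ii a] by (simp add: \<delta>_ii ii_commute[of a, symmetric] lm_ii scaleR_2)
  then show ?thesis by simp
qed

lemma defect_ii_left: "defect (ii * a) b = ii \<rhd> defect a b"
  by (simp add: defect_def \<delta>_ii_mult bimodule_simps mult.assoc)

lemma defect_ii_right: "defect a (ii * b) = ii \<rhd> defect a b"
  using defect_ii_left[of b a] defect_swap[of b a] defect_swap[of "ii * b" a]
  by (simp add: lm_minus_right)

text \<open>The element \<open>a * b * x * (b * a) + b * a * x * (a * b)\<close> is expanded twice: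
  as a linearized triple product with outer factors \<open>a * b\<close> and \<open>b * a\<close>,
  and as two nested triple products.\<close>

lemma defect_commutator:
  "defect a b \<lhd> (x * (a * b - b * a)) = - (((a * b - b * a) * x) \<rhd> defect a b)"
proof -
  have ba: "\<delta> (b * a) = a \<rhd> \<delta> b + b \<rhd> \<delta> a + \<delta> a \<lhd> b + \<delta> b \<lhd> a - \<delta> (a * b)"
    by (rule jordan_swap)
  have "\<delta> (a * b * x * (b * a)) + \<delta> (b * a * x * (a * b))
      = \<delta> (a * (b * x * b) * a) + \<delta> (b * (a * x * a) * b)"
    by (simp add: mult.assoc)
  then show ?thesis
    unfolding jordan_triple_product jordan_triple
    by (simp add: defect_def bimodule_simps ba algebra_simps)
qed

section \<open>Partial continuity and annihilators of the defect\<close>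

text \<open>The actions of \<open>'u\<close> on \<open>'x\<close> may be discontinuous in the first factor; \<open>tame\<close> is the
  remnant of continuity which boundedness of \<open>\<delta>\<close> forces on the defect.\<close>

definition tame :: "'x \<Rightarrow> bool" where
  "tame m \<longleftrightarrow> bounded_linear (\<lambda>c. c \<rhd> m + m \<lhd> c)"

lemma tame_diff: "tame m \<Longrightarrow> tame n \<Longrightarrow> tame (m - n)"
  unfolding tame_def by (drule (1) bounded_linear_sub) (simp add: bimodule_simps algebra_simps)

lemma tame_add: "tame m \<Longrightarrow> tame n \<Longrightarrow> tame (m + n)"
  unfolding tame_def by (drule (1) bounded_linear_add) (simp add: bimodule_simps algebra_simps)

lemma tame_scaleR: "tame m \<Longrightarrow> tame (r *\<^sub>R m)"
  unfolding tame_def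
  by (drule bounded_linear_compose[OF bounded_linear_scaleR_right[of r]])
    (simp add: bimodule_simps algebra_simps)

text \<open>By \<open>jordan_product\<close> the variable \<open>c\<close> can be confined to the
  argument of \<open>\<delta>\<close>, leaving only actions of the fixed \<open>a\<close>.\<close>

lemma tame_\<delta>: "tame (\<delta> a)"
proof -
  have eq: "(\<lambda>c. c \<rhd> \<delta> a + \<delta> a \<lhd> c) = (\<lambda>c. \<delta> (c * a) + \<delta> (a * c) - a \<rhd> \<delta> c - \<delta> c \<lhd> a)"
    unfolding jordan_product by (simp add: algebra_simps)
  show ?thesis
    unfolding tame_def eq
    by (intro bounded_linear_sub bounded_linear_add
        bounded_linear_compose[OF bounded_linear_\<delta> bounded_linear_mult_left]
        bounded_linear_compose[OF bounded_linear_\<delta> bounded_linear_mult_right]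
        bounded_linear_compose[OF bounded_linear_lm bounded_linear_\<delta>]
        bounded_linear_compose[OF bounded_linear_rm bounded_linear_\<delta>])
qed

lemma tame_commutator:
  assumes "tame x"
  shows "tame (a \<rhd> x - x \<lhd> a)"
proof -
  let ?T = "\<lambda>c. c \<rhd> x + x \<lhd> c"
  have eq: "(\<lambda>c. c \<rhd> (a \<rhd> x - x \<lhd> a) + (a \<rhd> x - x \<lhd> a) \<lhd> c)
      = (\<lambda>c. ?T (c * a) - ?T c \<lhd> a + (a \<rhd> ?T c - ?T (a * c)))"
    by (simp add: bimodule_simps algebra_simps)
  have T: "bounded_linear ?T" using assms by (simp add: tame_def)
  show ?thesis
    unfolding tame_def eq
    by (intro bounded_linear_sub bounded_linear_add
        bounded_linear_compose[OF T bounded_linear_mult_left]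
        bounded_linear_compose[OF T bounded_linear_mult_right]
        bounded_linear_compose[OF bounded_linear_lm T]
        bounded_linear_compose[OF bounded_linear_rm T])
qed

text \<open>By antisymmetry twice the defect combines \<open>\<delta> (a * b - b * a)\<close> with
  commutators of \<open>a\<close> and \<open>b\<close> with values of \<open>\<delta>\<close>, all
  of them tame.\<close>

lemma tame_defect: "tame (defect a b)"
proof -
  have "2 *\<^sub>R defect a b = defect a b - defect b a" by (simp add: defect_swap[of b a] scaleR_2)
  also have "\<dots> = \<delta> (a * b - b * a) - (a \<rhd> \<delta> b - \<delta> b \<lhd> a) + (b \<rhd> \<delta> a - \<delta> a \<lhd> b)"
    by (simp add: defect_def bimodule_simps algebra_simps)
  finally have "defect a b = (1/2) *\<^sub>R (\<delta> (a * b - b * a) - (a \<rhd> \<delta> b - \<delta> b \<lhd> a) + (b \<rhd> \<delta> a - \<delta> a \<lhd> b))"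
    by (metis scaleR_half_double scaleR_2)
  then show ?thesis
    by (simp only: tame_scaleR tame_add tame_diff tame_\<delta> tame_commutator)
qed

text \<open>The inserted factor \<open>x\<close> makes both conditions stable under multiplication
  from either side, so the set is a two-sided ideal.\<close>

definition annihilator :: "'x \<Rightarrow> 'u set" where
  "annihilator m = {c. \<forall>x. (c * x) \<rhd> m = 0 \<and> m \<lhd> (x * c) = 0}"

lemma annihilatorD:
  assumes "c \<in> annihilator m"
  shows "(c * x) \<rhd> m = 0" "m \<lhd> (x * c) = 0" "c \<rhd> m = 0" "m \<lhd> c = 0"
  using assms unfolding annihilator_def by (auto dest: spec[of _ 1])

lemma two_sided_ideal_annihilator: "two_sided_ideal (annihilator m)"
proof (rule two_sided_idealI)
  fix c y assume c: "c \<in> annihilator m"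
  have "(c * y * x) \<rhd> m = 0 \<and> m \<lhd> (x * (c * y)) = 0" for x
    using annihilatorD(1)[OF c, of "y * x"] annihilatorD(2)[OF c, of x] rm_mult[of m "x * c" y]
    by (simp add: mult.assoc)
  then show "c * y \<in> annihilator m" by (simp add: annihilator_def)
  have "(y * c * x) \<rhd> m = 0 \<and> m \<lhd> (x * (y * c)) = 0" for x
    using annihilatorD(1)[OF c, of x] annihilatorD(2)[OF c, of "x * y"] lm_mult[of y "c * x" m]
    by (simp add: mult.assoc)
  then show "y * c \<in> annihilator m" by (simp add: annihilator_def)
qed (auto simp: annihilator_def distrib_right distrib_left lm_add_left rm_add_right)

text \<open>On the closure \<open>a \<rhd> m = - (m \<lhd> a)\<close>, so products of two elements annihilate \<open>m\<close>, and
  the closure is generated by such products.\<close>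

lemma closure_annihilator:
  assumes "tame m"
  shows "closure (annihilator m) \<inter> A \<subseteq> annihilator m"
proof (rule closed_ideal_subset_if_products)
  let ?C = "closure (annihilator m)"
  have C: "two_sided_ideal ?C"
    by (rule two_sided_ideal_closure[OF two_sided_ideal_annihilator])
  show "two_sided_ideal (?C \<inter> A)" by (rule two_sided_ideal_Int[OF C ideal_A])
  show "closed (?C \<inter> A)" by (simp add: closed_A closed_Int)
  have T: "a \<rhd> m = - (m \<lhd> a)" if a: "a \<in> ?C" for a
  proof -
    obtain s where s: "\<And>n. s n \<in> annihilator m" "s \<longlonglongrightarrow> a"
      using a by (auto simp: closure_sequential)
    have "(\<lambda>n. s n \<rhd> m + m \<lhd> s n) \<longlonglongrightarrow> a \<rhd> m + m \<lhd> a"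
      using assms s(2) unfolding tame_def by (rule bounded_linear.tendsto)
    then show ?thesis
      using s(1) by (simp add: annihilatorD LIMSEQ_const_iff eq_neg_iff_add_eq_0)
  qed
  \<comment> \<open>Moving \<open>b\<close> and then \<open>a\<close> past \<open>m\<close> costs
    two signs, moving \<open>a * b\<close> at once costs one.\<close>
  have prod0: "(a * b) \<rhd> m = 0 \<and> m \<lhd> (a * b) = 0" if a: "a \<in> ?C" and b: "b \<in> ?C" for a b
  proof -
    have "(a * b) \<rhd> m = - (a \<rhd> (m \<lhd> b))"
      unfolding lm_mult[symmetric] T[OF b] lm_minus_right ..
    also have "\<dots> = m \<lhd> (a * b)"
      unfolding lm_rm[symmetric] T[OF a] rm_minus_left rm_mult by simp
    also have "\<dots> = - ((a * b) \<rhd> m)"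
      using T[OF ideal_mult_right[OF C a, of b]] by simp
    finally have "(a * b) \<rhd> m = 0" by (rule eq_minus_self_imp_zero)
    then show ?thesis using T[OF ideal_mult_right[OF C a, of b]] by simp
  qed
  show "p * q \<in> annihilator m" if p: "p \<in> ?C \<inter> A" and q: "q \<in> ?C \<inter> A" for p q
    unfolding annihilator_def
    using prod0[of p "q * x" for x] prod0[of "x * p" q for x] p q
    by (auto simp: ideal_mult_left[OF C] ideal_mult_right[OF C] mult.assoc)
qed (auto intro: ideal_add ideal_mult_left two_sided_ideal_annihilator)

lemma mem_annihilator_if_regular:
  assumes "tame m" "w \<in> A" "\<And>x. w * x * w \<in> annihilator m"
  shows "w \<in> annihilator m"
  using mem_closed_if_regular[of "closure (annihilator m)" w] closure_annihilator[OF assms(1)]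
    assms(2,3) closure_subset by blast

text \<open>For the commutator \<open>w\<close>, \<open>defect_commutator\<close> moves
  \<open>y * w * z * w\<close> past the defect in one step, with a minus sign, or in two steps, with
  a plus sign. So the result is \<open>0\<close>, which gives the claim for
  \<open>w * x * w\<close>, and regularity passes it on to \<open>w\<close>.\<close>

lemma commutator_in_annihilator_self: "a * b - b * a \<in> annihilator (defect a b)"
proof (rule mem_annihilator_if_regular[OF tame_defect commutator_A])
  fix x
  let ?m = "defect a b" and ?w = "a * b - b * a"
  have R: "?m \<lhd> (y * ?w) = - ((?w * y) \<rhd> ?m)" for y
    by (rule defect_commutator)
  have zero: "(?w * y * ?w * z) \<rhd> ?m = 0 \<and> ?m \<lhd> (y * ?w * z * ?w) = 0" for y z
  proof -
    have "?m \<lhd> (y * ?w * z * ?w) = - ((?w * y * ?w * z) \<rhd> ?m)"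
      using R[of "y * ?w * z"] by (simp only: mult.assoc)
    moreover have "?m \<lhd> (y * ?w * z * ?w) = (?m \<lhd> (y * ?w)) \<lhd> (z * ?w)"
      by (simp only: rm_mult mult.assoc)
    then have "?m \<lhd> (y * ?w * z * ?w) = (?w * y * ?w * z) \<rhd> ?m"
      unfolding R rm_minus_left lm_rm lm_minus_right by (simp add: lm_mult mult.assoc)
    ultimately show ?thesis
      using eq_minus_self_imp_zero[of "(?w * y * ?w * z) \<rhd> ?m"] by metis
  qed
  show "?w * x * ?w \<in> annihilator ?m"
    unfolding annihilator_def using zero[of x] zero[of _ x] by (simp add: mult.assoc)
qed

text \<open>\<open>left\<close> and \<open>right\<close> are the mixed terms of a linearized
  relation. One more factor \<open>w\<close> turns the term with \<open>m\<close> into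
  \<open>0\<close>, so \<open>w * x * w\<close> annihilates \<open>n\<close>.\<close>

lemma annihilator_polarize:
  assumes "tame n" "w \<in> A" and w: "w \<in> annihilator m"
    and left: "\<And>y. (w * y) \<rhd> n = - ((v * y) \<rhd> m)"
    and right: "\<And>y. n \<lhd> (y * w) = - (m \<lhd> (y * v))"
  shows "w \<in> annihilator n"
proof (rule mem_annihilator_if_regular[OF assms(1,2)])
  fix x
  have "(w * x * w * y) \<rhd> n = 0" for y
  proof -
    have "(w * x * w * y) \<rhd> n = (w * x) \<rhd> (w * y) \<rhd> n" by (simp add: lm_mult mult.assoc)
    also have "\<dots> = - ((w * (x * v * y)) \<rhd> m)"
      unfolding left by (simp add: lm_minus_right lm_mult mult.assoc)
    finally show ?thesis using annihilatorD(1)[OF w] by simp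
  qed
  moreover have "n \<lhd> (y * (w * x * w)) = 0" for y
  proof -
    have "n \<lhd> (y * (w * x * w)) = (n \<lhd> (y * w)) \<lhd> (x * w)" by (simp add: rm_mult mult.assoc)
    also have "\<dots> = - (m \<lhd> ((y * v * x) * w))"
      unfolding right by (simp add: rm_minus_left rm_mult mult.assoc)
    finally show ?thesis using annihilatorD(2)[OF w] by simp
  qed
  ultimately show "w * x * w \<in> annihilator n" by (simp add: annihilator_def mult.assoc)
qed

text \<open>Linearizes the preceding result in \<open>b\<close>, where only mixed terms survive; the
  next lemma then linearizes in the first argument.\<close>

lemma commutator_in_annihilator_left: "a * b - b * a \<in> annihilator (defect a c)"
proof (rule annihilator_polarize[OF tame_defect commutator_A commutator_in_annihilator_self])
  let ?w = "a * b - b * a" and ?v = "a * c - c * a"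
  have sum: "?w + ?v \<in> annihilator (defect a b + defect a c)"
    using commutator_in_annihilator_self[of a "b + c"]
    by (simp add: defect_add_right algebra_simps)
  note ann = annihilatorD(1,2)[OF commutator_in_annihilator_self]
  show "(?w * y) \<rhd> defect a c = - ((?v * y) \<rhd> defect a b)" for y
    using annihilatorD(1)[OF sum, of y] ann(1)[of a b y] ann(1)[of a c y]
    by (simp only: distrib_right lm_add_left lm_add_right add_0 add_0_right eq_neg_iff_add_eq_0 add.commute)
  show "defect a c \<lhd> (y * ?w) = - (defect a b \<lhd> (y * ?v))" for y
    using annihilatorD(2)[OF sum, of y] ann(2)[of a b y] ann(2)[of a c y]
    by (simp only: distrib_left rm_add_left rm_add_right add_0 add_0_right eq_neg_iff_add_eq_0 add.commute)
qed

lemma commutator_in_annihilator: "a * b - b * a \<in> annihilator (defect c d)"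
proof (rule annihilator_polarize[OF tame_defect commutator_A commutator_in_annihilator_left])
  let ?w = "a * b - b * a" and ?v = "c * b - b * c"
  have sum: "?w + ?v \<in> annihilator (defect a d + defect c d)"
    using commutator_in_annihilator_left[of "a + c" b d]
    by (simp add: defect_add_left algebra_simps)
  note ann = annihilatorD(1,2)[OF commutator_in_annihilator_left]
  show "(?w * y) \<rhd> defect c d = - ((?v * y) \<rhd> defect a d)" for y
    using annihilatorD(1)[OF sum, of y] ann(1)[of a b y d] ann(1)[of c b y d]
    by (simp only: distrib_right lm_add_left lm_add_right add_0 add_0_right eq_neg_iff_add_eq_0 add.commute)
  show "defect c d \<lhd> (y * ?w) = - (defect a d \<lhd> (y * ?v))" for y
    using annihilatorD(2)[OF sum, of y] ann(2)[of a d y b] ann(2)[of c d y b]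
    by (simp only: distrib_left rm_add_left rm_add_right add_0 add_0_right eq_neg_iff_add_eq_0 add.commute)
qed

definition annihilator_all :: "'u set" where
  "annihilator_all = (\<Inter>c d. annihilator (defect c d))"

lemma two_sided_ideal_annihilator_all: "two_sided_ideal annihilator_all"
  unfolding annihilator_all_def
  by (rule two_sided_idealI)
    (auto intro: ideal_zero ideal_add ideal_mult_left ideal_mult_right two_sided_ideal_annihilator)

text \<open>The module terms of the cocycle identity vanish on this ideal, so a cyclic shift of the
  arguments of \<open>defect (a * b) c\<close> changes its sign. Three shifts return to the start
  with a minus sign.\<close>

lemma defect_annihilator_products:
  assumes "p \<in> annihilator_all" "q \<in> annihilator_all" "r \<in> annihilator_all"
  shows "defect (p * q) r = 0"
proof -
  have ann: "a \<rhd> defect c d = 0" "defect c d \<lhd> a = 0" if "a \<in> annihilator_all" for a c d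
    using that by (auto simp: annihilator_all_def dest: annihilatorD(3,4))
  have cyc: "defect (a * b) c = - defect (b * c) a"
    if "a \<in> annihilator_all" "b \<in> annihilator_all" "c \<in> annihilator_all" for a b c
    using defect_cocycle[of a b c] that by (simp add: ann defect_swap[of "b * c" a])
  have "defect (p * q) r = - defect (p * q) r"
    using cyc[of p q r] cyc[of q r p] cyc[of r p q] assms by simp
  then show ?thesis by (rule eq_minus_self_imp_zero)
qed

lemma defect_commutator_right: "defect a (b * c - c * b) = 0"
proof -
  let ?P = "closure annihilator_all \<inter> A"
  have ideal: "two_sided_ideal ?P"
    by (intro two_sided_ideal_Int two_sided_ideal_closure two_sided_ideal_annihilator_all ideal_A)
  have closed: "closed ?P" by (simp add: closed_A closed_Int)
  have "closure annihilator_all \<subseteq> closure (annihilator (defect c d))" for c d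
    by (rule closure_mono) (auto simp: annihilator_all_def)
  then have P: "?P \<subseteq> annihilator_all"
    using closure_annihilator[OF tame_defect] by (fastforce simp: annihilator_all_def)
  \<comment> \<open>First pass: the defect vanishes on products in the first argument by
    \<open>defect_annihilator_products\<close>.\<close>
  have "?P \<subseteq> {p. \<forall>r\<in>annihilator_all. defect p r = 0}"
    by (rule closed_ideal_subset_if_products[OF ideal closed])
      (use subsetD[OF P] in \<open>auto simp: defect_annihilator_products defect_add_left defect_ii_left\<close>)
  then have PP: "defect p r = 0" if "p \<in> ?P" "r \<in> ?P" for p r using that P by blast
  \<comment> \<open>Second pass: now the cocycle identity for \<open>a\<close>, \<open>p\<close>,
    \<open>q\<close> leaves only \<open>defect a (p * q)\<close>.\<close>
  have "?P \<subseteq> {p. \<forall>a. defect a p = 0}"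
  proof (rule closed_ideal_subset_if_products[OF ideal closed])
    fix p q assume p: "p \<in> ?P" and q: "q \<in> ?P"
    have "defect a p \<lhd> q = 0" for a
      using q P by (auto simp: annihilator_all_def dest: annihilatorD(4))
    moreover have "defect (a * p) q = 0" "defect p q = 0" for a
      using PP[OF ideal_mult_left[OF ideal p] q] PP[OF p q] .
    ultimately show "p * q \<in> {p. \<forall>a. defect a p = 0}"
      using defect_cocycle[of _ p q] by simp
  qed (auto simp: defect_add_right defect_ii_right)
  moreover have "b * c - c * b \<in> ?P"
    using commutator_in_annihilator closure_subset commutator_A by (fastforce simp: annihilator_all_def)
  ultimately show ?thesis by blast
qed

section \<open>The defect as a derivation into a symmetric module\<close>

lemma defect_mult_commute: "defect a (b * c) = defect a (c * b)"
  using defect_commutator_right[of a b c] by (simp add: defect_diff_right)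

lemma lm_defect_commute: "(a * b) \<rhd> defect c d = (b * a) \<rhd> defect c d"
  using annihilatorD(3)[OF commutator_in_annihilator, of a b c d] by (simp add: lm_diff_left)

text \<open>The cocycle identity and \<open>defect_triple_right\<close> evaluate the same sum of two
  defects; comparing the results gives the symmetry.\<close>

lemma rm_defect: "defect b c \<lhd> a = a \<rhd> defect b c"
proof -
  have "defect a (c * b) + defect c (a * b) = defect a b \<lhd> c - a \<rhd> defect b c"
    using defect_cocycle[of a b c] defect_mult_commute[of a b c] defect_swap[of "a * b" c]
    by (simp add: algebra_simps)
  moreover have "defect a (c * b) + defect c (a * b) = defect a b \<lhd> c + defect c b \<lhd> a"
    using defect_triple_right[of a b c] defect_swap[of "a * b" c] defect_swap[of "c * b" a]
    by (simp add: algebra_simps)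
  ultimately show ?thesis
    using defect_swap[of c b] by (simp add: rm_minus_left)
qed

text \<open>\<open>defect_triple_left\<close> determines the pairwise sums of the three cyclic
  values \<open>?X\<close>, \<open>?Y\<close>, \<open>?Z\<close>; solving this linear system gives
  \<open>?X\<close>.\<close>

lemma defect_derivation: "defect a (b * c) = b \<rhd> defect a c + c \<rhd> defect a b"
proof -
  have T: "defect x (y * z) + defect z (y * x) = x \<rhd> defect z y + z \<rhd> defect x y" for x y z
  proof -
    have "defect x (y * z) + defect z (y * x) = - (x \<rhd> defect y z + z \<rhd> defect y x)"
      using defect_triple_left[of x y z] by (simp only: eq_neg_iff_add_eq_0 add_ac)
    then show ?thesis
      using defect_swap[of z y] defect_swap[of x y] by (simp add: lm_minus_right)
  qed
  let ?X = "defect a (b * c)" and ?Y = "defect b (c * a)" and ?Z = "defect c (a * b)"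
  have sums: "?X + ?Z = a \<rhd> defect c b + c \<rhd> defect a b"
    "?X + ?Y = a \<rhd> defect b c + b \<rhd> defect a c"
    "?Y + ?Z = b \<rhd> defect c a + c \<rhd> defect b a"
    using T[of a b c] T[of a c b] T[of b a c] defect_mult_commute by metis+
  have "2 *\<^sub>R ?X = (?X + ?Z) + (?X + ?Y) - (?Y + ?Z)" by (simp add: scaleR_2)
  also have "\<dots> = 2 *\<^sub>R (b \<rhd> defect a c + c \<rhd> defect a b)"
    unfolding sums using defect_swap[of b a] defect_swap[of c a] defect_swap[of c b]
    by (simp add: lm_minus_right scaleR_2)
  finally have "2 *\<^sub>R ?X = 2 *\<^sub>R (b \<rhd> defect a c + c \<rhd> defect a b)" .
  then show ?thesis by simp
qed

text \<open>By symmetry the map in \<open>tame\<close> is twice the left action on the defect, so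
  this action is continuous in \<open>c\<close>.\<close>

lemma bounded_linear_lm_defect: "bounded_linear (\<lambda>c. c \<rhd> defect a b)"
proof -
  have "bounded_linear (\<lambda>c. (1/2) *\<^sub>R (c \<rhd> defect a b + defect a b \<lhd> c))"
    using bounded_linear_compose[OF bounded_linear_scaleR_right tame_defect[unfolded tame_def]] .
  then show ?thesis by (simp add: rm_defect scaleR_half_double)
qed

end

subsection \<open>Derivations into symmetric modules\<close>

text \<open>The model is \<open>D = defect a\<close>, whose term \<open>\<delta> a \<lhd> b\<close>
  may be discontinuous in \<open>b\<close>; continuity is available for the action on each fixed
  \<open>D b\<close>.\<close>

locale symmetric_derivation = cstar_ideal star A ii + normed_left_module lm
  for star :: "'u::{real_normed_algebra_1,banach} \<Rightarrow> 'u" and A ii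
    and lm :: "'u \<Rightarrow> 'x::real_normed_vector \<Rightarrow> 'x"  (infixr "\<rhd>" 68) +
  fixes D :: "'u \<Rightarrow> 'x"
  assumes D_add: "D (b + c) = D b + D c"
    and D_scaleR: "D (r *\<^sub>R b) = r *\<^sub>R D b"
    and D_ii: "D (ii * b) = ii \<rhd> D b"
    and D_mult: "D (b * c) = b \<rhd> D c + c \<rhd> D b"
    and lm_D_commute: "(a * b) \<rhd> D c = (b * a) \<rhd> D c"
    and bounded_linear_lm_D: "bounded_linear (\<lambda>c. c \<rhd> D b)"
begin

lemma D_diff: "D (b - c) = D b - D c"
  using D_add[of b "(-1) *\<^sub>R c"] D_scaleR[of "-1" c] by simp

lemma D_zero [simp]: "D 0 = 0"
  using D_scaleR[of 0 0] by simp

lemma D_of_real [simp]: "D (of_real t) = 0"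
  using D_mult[of 1 1] D_scaleR[of t 1] by (simp add: of_real_def)

definition F :: "'u set" where
  "F = {c. \<forall>b. c \<rhd> D b = 0}"

lemma memF_D: "c \<in> F \<Longrightarrow> c \<rhd> D b = 0"
  by (simp add: F_def)

lemma two_sided_ideal_F: "two_sided_ideal F"
proof (rule two_sided_idealI)
  fix c y assume c: "c \<in> F"
  then have *: "(y * c) \<rhd> D b = 0" for b by (simp add: F_def flip: lm_mult)
  then show "y * c \<in> F" by (simp add: F_def)
  show "c * y \<in> F" using * lm_D_commute[of c y] by (simp add: F_def)
qed (auto simp: F_def lm_add_left)

lemma closed_F: "closed F"
proof -
  have "F = (\<Inter>b. {c. c \<rhd> D b = 0})" by (auto simp: F_def)
  moreover have "closed {c. c \<rhd> D b = 0}" for b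
    by (intro closed_Collect_eq linear_continuous_on[OF bounded_linear_lm_D] continuous_on_const)
  ultimately show ?thesis by (simp add: closed_INT)
qed

lemma F_commute: "a * b \<in> F \<Longrightarrow> b * a \<in> F"
  by (simp add: F_def lm_D_commute[of b a])

lemma D_ii_eq_zero [simp]: "D ii = 0"
  using D_ii[of 1] D_of_real[of 1] by simp

text \<open>\<open>D\<close> vanishes on products of two elements of \<open>F\<close> by the product
  rule, and \<open>closed_ideal_subset_if_products\<close> extends this without continuity of
  \<open>D\<close>.\<close>

lemma D_zero_on_F:
  assumes "c \<in> F" "c \<in> A"
  shows "D c = 0"
proof -
  have "F \<inter> A \<subseteq> {c. D c = 0}"
    by (rule closed_ideal_subset_if_products)
      (auto simp: two_sided_ideal_Int two_sided_ideal_F ideal_A closed_Int closed_F closed_A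
        D_add D_mult memF_D)
  then show ?thesis using assms by blast
qed

lemma F_semiprime:
  assumes "f \<in> A" "f * f \<in> F"
  shows "f \<in> F"
proof (rule mem_closed_if_regular[OF closed_F assms(1)])
  fix x
  have "(f * x * f) \<rhd> D b = (f * f * x) \<rhd> D b" for b
    using lm_D_commute[of x f b] by (simp add: mult.assoc flip: lm_mult)
  then show "f * x * f \<in> F"
    using ideal_mult_right[OF two_sided_ideal_F assms(2), of x] by (simp add: F_def)
qed

lemma memF_if_small_selfadjoint:
  assumes "0 < r" and small: "\<And>h. star h = h \<Longrightarrow> norm h < r \<Longrightarrow> c \<rhd> D h = 0"
  shows "c \<in> F"
proof -
  have sa: "c \<rhd> D h = 0" if "star h = h" for h
  proof -
    define s where "s = r / (2 * norm h + 2)"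
    have "0 < s" using \<open>0 < r\<close> by (simp add: s_def add_nonneg_pos)
    have "norm (s *\<^sub>R h) < r"
      using \<open>0 < r\<close> by (simp add: s_def divide_simps add_nonneg_pos)
    then have "c \<rhd> D (s *\<^sub>R h) = 0"
      by (intro small) (simp add: star_scaleR that)
    then show ?thesis using \<open>0 < s\<close> by (simp add: D_scaleR lm_scaleR_right)
  qed
  have "c \<rhd> D b = 0" for b
  proof -
    obtain h k where "star h = h" "star k = k" "b = h + ii * k"
      using selfadjoint_decomposition by metis
    then show ?thesis
      using sa by (simp add: D_add D_ii lm_add_right lm_mult ii_commute[of c, symmetric] flip: lm_mult[of ii c])
  qed
  then show ?thesis by (simp add: F_def)
qed

lemma D_power_Suc: "D (u ^ Suc n) = real (Suc n) *\<^sub>R (u ^ n \<rhd> D u)"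
proof (induction n)
  case (Suc n)
  have "D (u ^ Suc (Suc n)) = u \<rhd> D (u ^ Suc n) + u ^ Suc n \<rhd> D u"
    by (subst power_Suc) (rule D_mult)
  then show ?case unfolding Suc by (simp add: lm_simps algebra_simps scaleR_2)
qed simp

text \<open>For unitary \<open>u\<close> the derivative \<open>D (u ^ n)\<close> grows linearly in \<open>n\<close> unless it vanishes.\<close>

lemma memF_if_bounded:
  assumes bound: "\<And>b. norm (c \<rhd> D b) \<le> K * norm b"
  shows "c \<in> F"
proof -
  \<comment> \<open>Banach-Steinhaus gives a bound that is joint in \<open>a\<close> and
    \<open>b\<close>. It is applied to \<open>a = star (u ^ m)\<close>, whose action has no evident
    bound uniform in \<open>m\<close>.\<close>
  have "\<exists>K. \<forall>b\<in>{b. norm b \<le> 1}. \<forall>a. norm ((a * c) \<rhd> D b) \<le> K * norm a"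
  proof (rule uniform_boundedness)
    show "bounded_linear (\<lambda>a. (a * c) \<rhd> D b)" for b
      by (rule bounded_linear_compose[OF bounded_linear_lm_D bounded_linear_mult_left])
    fix a
    obtain Ka where "0 < Ka" and Ka: "\<And>x. norm (a \<rhd> x) \<le> norm x * Ka"
      using bounded_linear.pos_bounded[OF bounded_linear_lm] by blast
    have "norm ((a * c) \<rhd> D b) \<le> \<bar>K\<bar> * Ka" if "norm b \<le> 1" for b
    proof -
      have "norm ((a * c) \<rhd> D b) \<le> norm (c \<rhd> D b) * Ka"
        using Ka by (simp flip: lm_mult)
      also have "\<dots> \<le> \<bar>K\<bar> * Ka"
      proof (rule mult_right_mono)
        have "K * norm b \<le> \<bar>K\<bar> * 1" using that by (intro mult_mono) auto
        then show "norm (c \<rhd> D b) \<le> \<bar>K\<bar>" using bound[of b] by simp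
      qed (use \<open>0 < Ka\<close> in simp)
      finally show ?thesis .
    qed
    then show "\<exists>M. \<forall>b\<in>{b. norm b \<le> 1}. norm ((a * c) \<rhd> D b) \<le> M" by blast
  qed
  then obtain K' where K': "\<And>a b. norm b \<le> 1 \<Longrightarrow> norm ((a * c) \<rhd> D b) \<le> K' * norm a"
    by blast
  have unitary_zero: "c \<rhd> D u = 0" if u: "unitary u" for u
  proof -
    \<comment> \<open>One factor \<open>3\<close> bounds \<open>star (u ^ m)\<close>, the other
      brings \<open>u ^ n\<close> into the unit ball.\<close>
    have le: "real n * norm (c \<rhd> D u) \<le> 9 * \<bar>K'\<bar>" for n
    proof (cases n)
      case (Suc m)
      let ?s = "star (u ^ m)"
      have su: "?s * u ^ m = 1" using unitary_power[OF u] by (simp add: unitary_def)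
      have "(?s * c) \<rhd> u ^ m \<rhd> D u = ?s \<rhd> (c * u ^ m) \<rhd> D u"
        by (simp add: lm_mult mult.assoc)
      also have "\<dots> = ?s \<rhd> (u ^ m * c) \<rhd> D u" by (simp only: lm_D_commute[of c])
      also have "\<dots> = (?s * u ^ m) \<rhd> c \<rhd> D u" by (simp add: lm_mult mult.assoc)
      finally have "(?s * c) \<rhd> D (u ^ n) = real n *\<^sub>R (c \<rhd> D u)"
        unfolding Suc D_power_Suc by (simp add: lm_scaleR_right su)
      moreover have "(?s * c) \<rhd> D ((1/3) *\<^sub>R u ^ n) = (1/3) *\<^sub>R ((?s * c) \<rhd> D (u ^ n))"
        by (simp add: D_scaleR lm_scaleR_right)
      moreover have "norm ((?s * c) \<rhd> D ((1/3) *\<^sub>R u ^ n)) \<le> K' * norm ?s"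
        using unitary_norm[OF unitary_power[OF u, of n]] by (intro K') simp
      moreover have "K' * norm ?s \<le> \<bar>K'\<bar> * 3"
        using unitary_norm[OF unitary_star[OF unitary_power[OF u, of m]]] by (intro mult_mono) auto
      ultimately show ?thesis by simp
    qed simp
    show ?thesis
    proof (rule ccontr)
      assume "c \<rhd> D u \<noteq> 0"
      then obtain n :: nat where "9 * \<bar>K'\<bar> / norm (c \<rhd> D u) < real n"
        using reals_Archimedean2 by blast
      with le[of n] \<open>c \<rhd> D u \<noteq> 0\<close> show False by (simp add: field_simps)
    qed
  qed
  show ?thesis
  proof (rule memF_if_small_selfadjoint)
    fix h assume "star h = h" "norm h < 1/2"
    then obtain u where u: "unitary u" "u - star u = 2 *\<^sub>R (ii * h)"
      using unitary_exists[of h] by auto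
    have "c \<rhd> D (u - star u) = 0"
      using unitary_zero[OF u(1)] unitary_zero[OF unitary_star[OF u(1)]]
      by (simp add: D_diff lm_diff_right)
    then have "(ii * c) \<rhd> D h = 0"
      unfolding u(2) by (simp add: D_scaleR D_ii lm_scaleR_right lm_mult ii_commute[of c])
    then have "ii \<rhd> (ii * c) \<rhd> D h = 0" by simp
    then show "c \<rhd> D h = 0" by (simp add: lm_mult mult_ii_ii lm_minus_left)
  qed simp
qed

section \<open>Gliding hump and atoms\<close>

lemma unbounded_if_not_memF:
  assumes "c \<notin> F" "0 < e"
  shows "\<exists>b. norm b \<le> e \<and> L \<le> norm (c \<rhd> D b)"
proof -
  obtain b where b: "(\<bar>L\<bar> / e) * norm b < norm (c \<rhd> D b)"
    using memF_if_bounded[of c "\<bar>L\<bar> / e"] assms(1) by (meson not_less)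
  then have "b \<noteq> 0" by auto
  let ?b = "(e / norm b) *\<^sub>R b"
  have "norm (c \<rhd> D ?b) = (e / norm b) * norm (c \<rhd> D b)"
    using assms(2) by (simp add: D_scaleR lm_scaleR_right)
  then have "L \<le> norm (c \<rhd> D ?b)"
    using b \<open>b \<noteq> 0\<close> assms(2) by (simp add: field_simps) (smt (verit) mult_le_cancel_right_pos zero_less_norm_iff abs_ge_self mult.commute)
  then show ?thesis using assms(2) \<open>b \<noteq> 0\<close> by (intro exI[of _ ?b]) simp
qed

text \<open>Gliding hump: \<open>D\<close> would send the sum of suitable small multiples of the \<open>f j\<close> to an element
  of arbitrarily large norm.\<close>

lemma no_orthogonal_sequence:
  fixes f :: "nat \<Rightarrow> 'u"
  assumes f: "\<And>j. f j \<in> A" "\<And>j. f j \<notin> F" and orth: "\<And>i j. i \<noteq> j \<Longrightarrow> f i * f j \<in> F"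
  shows False
proof -
  have "\<exists>\<kappa>. \<forall>x. norm (f j \<rhd> x) \<le> norm x * \<kappa>" for j
    using bounded_linear.bounded[OF bounded_linear_lm] .
  then obtain \<kappa> where \<kappa>: "\<And>j x. norm (f j \<rhd> x) \<le> norm x * \<kappa> j" by metis
  have "\<exists>M>0. \<forall>c. norm (c \<rhd> D (f j)) \<le> norm c * M" for j
    using bounded_linear.pos_bounded[OF bounded_linear_lm_D] .
  then obtain M where M: "\<And>j c. norm (c \<rhd> D (f j)) \<le> norm c * M j" "\<And>j. 0 < M j" by metis
  have "\<exists>M>0. \<forall>c. norm (c \<rhd> D (f j * f j)) \<le> norm c * M" for j
    using bounded_linear.pos_bounded[OF bounded_linear_lm_D] .
  then obtain M' where M': "\<And>j c. norm (c \<rhd> D (f j * f j)) \<le> norm c * M' j" "\<And>j. 0 < M' j" by metis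
  \<comment> \<open>The upper bound makes the sum of the \<open>f j * b j\<close> converge. The
    lower bound outweighs the error terms and still leaves \<open>j\<close> times the bound
    \<open>\<kappa> j\<close> for the action of \<open>f j\<close>.\<close>
  have "\<exists>b. norm b \<le> (1/2) ^ j / (norm (f j) + 1) \<and>
      real j * \<bar>\<kappa> j\<bar> + 2 * M j + M' j + 1 \<le> norm ((f j * f j) \<rhd> D b)" for j
    using f F_semiprime by (intro unbounded_if_not_memF) (auto simp: add_nonneg_pos)
  then obtain b where b: "\<And>j. norm (b j) \<le> (1/2) ^ j / (norm (f j) + 1)"
    "\<And>j. real j * \<bar>\<kappa> j\<bar> + 2 * M j + M' j + 1 \<le> norm ((f j * f j) \<rhd> D (b j))" by metis
  have norm_b: "norm (b j) \<le> 1" for j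
  proof -
    have "(1/2 :: real) ^ j / (norm (f j) + 1) \<le> 1 / 1"
      by (intro frac_le) (auto simp: power_le_one)
    then show ?thesis using b(1)[of j] by simp
  qed
  have norm_fb: "norm (f j * b j) \<le> (1/2) ^ j" for j
  proof -
    have "norm (f j * b j) \<le> norm (f j) * norm (b j)" by (rule norm_mult_ineq)
    also have "\<dots> \<le> (norm (f j) + 1) * ((1/2) ^ j / (norm (f j) + 1))"
      by (intro mult_mono b) (auto simp: add_nonneg_pos)
    also have "\<dots> = (1/2) ^ j"
      by (simp add: add_nonneg_eq_0_iff)
    finally show ?thesis .
  qed
  have geo: "summable (\<lambda>j. (1/2 :: real) ^ j)" by (rule summable_geometric) simp
  have summable: "summable (\<lambda>j. norm (f j * b j))"
    by (rule summable_comparison_test[OF _ geo]) (use norm_fb in auto)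
  define c where "c = (\<Sum>j. f j * b j)"
  have c: "(\<lambda>n. \<Sum>i<n. f i * b i) \<longlonglongrightarrow> c"
    unfolding c_def by (rule summable_LIMSEQ[OF summable_norm_cancel[OF summable]])
  have "norm c \<le> (\<Sum>j. norm (f j * b j))" unfolding c_def by (rule summable_norm[OF summable])
  also have "\<dots> \<le> (\<Sum>j. (1/2) ^ j)" by (rule suminf_le[OF norm_fb summable geo])
  also have "\<dots> = 2" by (simp add: suminf_geometric)
  finally have norm_c: "norm c \<le> 2" .
  have lower: "real j * \<bar>\<kappa> j\<bar> + 1 \<le> norm (D c) * \<kappa> j" for j
  proof -
    \<comment> \<open>Modulo the closed ideal \<open>F\<close>, multiplication by \<open>f j\<close>
      singles out the \<open>j\<close>-th summand of \<open>c\<close>.\<close>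
    have "f j * c - f j * (f j * b j) \<in> F"
    proof (rule Lim_in_closed_set[OF closed_F])
      show "(\<lambda>n. f j * (\<Sum>i<n. f i * b i) - f j * (f j * b j)) \<longlonglongrightarrow> f j * c - f j * (f j * b j)"
        by (intro tendsto_intros c)
      show "\<forall>\<^sub>F n in sequentially. f j * (\<Sum>i<n. f i * b i) - f j * (f j * b j) \<in> F"
        using eventually_gt_at_top[of j]
      proof eventually_elim
        case (elim n)
        have "f j * (\<Sum>i<n. f i * b i) - f j * (f j * b j) = f j * (\<Sum>i\<in>{..<n} - {j}. f i * b i)"
          using elim by (subst sum.remove[of _ j]) (auto simp: algebra_simps)
        also have "\<dots> = (\<Sum>i\<in>{..<n} - {j}. f j * f i * b i)"
          by (simp add: sum_distrib_left mult.assoc)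
        also have "\<dots> \<in> F"
          by (intro subspace_sum ideal_subspace ideal_mult_right two_sided_ideal_F orth) auto
        finally show ?case .
      qed
    qed simp
    moreover have "f j * c - f j * (f j * b j) \<in> A"
      by (intro ideal_diff ideal_mult_right ideal_A f)
    ultimately have "D (f j * c) = D (f j * f j * b j)"
      using D_zero_on_F[of "f j * c - f j * (f j * b j)"] by (simp add: D_diff mult.assoc)
    then have "(f j * f j) \<rhd> D (b j) = f j \<rhd> D c + c \<rhd> D (f j) - b j \<rhd> D (f j * f j)"
      by (simp add: D_mult[of "f j" c] D_mult[of "f j * f j" "b j"])
    then have "norm ((f j * f j) \<rhd> D (b j))
        \<le> norm (f j \<rhd> D c) + norm (c \<rhd> D (f j)) + norm (b j \<rhd> D (f j * f j))"
      using norm_triangle_ineq4[of "f j \<rhd> D c + c \<rhd> D (f j)" "b j \<rhd> D (f j * f j)"]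
        norm_triangle_ineq[of "f j \<rhd> D c" "c \<rhd> D (f j)"] by simp
    moreover have "norm (c \<rhd> D (f j)) \<le> 2 * M j"
      using M(1)[of c j] mult_right_mono[OF norm_c less_imp_le[OF M(2)[of j]]] by linarith
    moreover have "norm (b j \<rhd> D (f j * f j)) \<le> 1 * M' j"
      using M'(1)[of "b j" j] mult_right_mono[OF norm_b[of j] less_imp_le[OF M'(2)[of j]]] by linarith
    ultimately show ?thesis using b(2)[of j] \<kappa>[of j "D c"] by linarith
  qed
  obtain j :: nat where "norm (D c) < real j" using reals_Archimedean2 by blast
  then have "norm (D c) * \<bar>\<kappa> j\<bar> \<le> real j * \<bar>\<kappa> j\<bar>" by (intro mult_right_mono) auto
  moreover have "norm (D c) * \<kappa> j \<le> norm (D c) * \<bar>\<kappa> j\<bar>" by (intro mult_left_mono) auto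
  ultimately show False using lower[of j] by simp
qed

text \<open>Otherwise splitting never stops: \<open>q (Suc n) = q n * Y (q n)\<close> is split
  again, and \<open>p n = q n * X (q n)\<close> is put aside. For \<open>i < j\<close> the element
  \<open>p j\<close> is a right multiple of \<open>q (Suc i)\<close>, so the \<open>p n\<close> form
  a sequence excluded by \<open>no_orthogonal_sequence\<close>.\<close>

lemma exists_atom:
  assumes "f0 \<in> A" "f0 \<notin> F"
  obtains f where "f \<in> A" "f \<notin> F" "\<And>x y. f * x * (f * y) \<in> F \<Longrightarrow> f * x \<in> F \<or> f * y \<in> F"
proof (rule ccontr)
  note atomI = that
  assume no: "\<not> thesis"
  have "\<exists>x y. f * x * (f * y) \<in> F \<and> f * x \<notin> F \<and> f * y \<notin> F" if "f \<in> A" "f \<notin> F" for f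
    using no atomI[OF that] by blast
  then obtain X Y where XY: "f * X f * (f * Y f) \<in> F" "f * X f \<notin> F" "f * Y f \<notin> F"
    if "f \<in> A" "f \<notin> F" for f by metis
  define q where "q = rec_nat f0 (\<lambda>_ g. g * Y g)"
  have q_Suc: "q (Suc n) = q n * Y (q n)" for n by (simp add: q_def)
  have q: "q n \<in> A \<and> q n \<notin> F" for n
  proof (induction n)
    case (Suc n)
    then show ?case using XY by (auto simp: q_Suc ideal_mult_right[OF ideal_A])
  qed (use assms in \<open>simp add: q_def\<close>)
  have q_dvd: "\<exists>z. q (n + k) = q n * z" for n k
  proof (induction k)
    case (Suc k)
    then show ?case by (auto simp: q_Suc mult.assoc)
  qed (auto intro: exI[of _ 1])
  define p where "p n = q n * X (q n)" for n
  have less: "p i * p j \<in> F" if "i < j" for i j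
  proof -
    have "Suc i + (j - Suc i) = j" using that by simp
    then obtain z where "q j = q (Suc i) * z" using q_dvd by metis
    then have "p i * p j = q i * X (q i) * (q i * Y (q i)) * (z * X (q j))"
      by (simp add: p_def q_Suc mult.assoc)
    then show ?thesis using XY(1) q by (simp add: ideal_mult_right[OF two_sided_ideal_F])
  qed
  show False
  proof (rule no_orthogonal_sequence[of p])
    show "p j \<in> A" "p j \<notin> F" for j
      using q XY(2) by (auto simp: p_def ideal_mult_right[OF ideal_A])
    show "p i * p j \<in> F" if "i \<noteq> j" for i j
      using less F_commute that by (metis nat_neq_iff)
  qed
qed

theorem A_subset_F: "A \<subseteq> F"
proof (rule ccontr)
  assume "\<not> A \<subseteq> F"
  then obtain f where f: "f \<in> A" "f \<notin> F"
    and atom: "\<And>x y. f * x * (f * y) \<in> F \<Longrightarrow> f * x \<in> F \<or> f * y \<in> F"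
    using exists_atom by (metis subsetI)
  obtain \<rho> where \<rho>: "0 < \<rho>" "\<rho> \<le> 1/4"
    "\<And>h. star h = h \<Longrightarrow> norm h < \<rho> \<Longrightarrow> cabs (of_real (1/4) + h) = of_real (1/4) + h"
    using cabs_near_quarter by blast
  \<comment> \<open>Heuristically \<open>f\<close> is concentrated at one point, and
    \<open>- t\<close> is the value of \<open>h\<close> there.\<close>
  have "\<exists>t. f * (of_real t + h) \<in> F" if h: "star h = h" "norm h < \<rho>" for h
  proof -
    let ?g = "\<lambda>t. of_real t + h" and ?I = "{-1/4..1/4 :: real}"
    have g: "star (?g t) = ?g t" "norm (?g t) \<le> 1/2" if "t \<in> ?I" for t
    proof -
      have "\<bar>t\<bar> \<le> 1/4" using that by (auto intro: abs_leI)
      then have "norm (of_real t :: 'u) \<le> 1/4" by (simp only: norm_of_real)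
      then show "norm (?g t) \<le> 1/2"
        using norm_triangle_ineq[of "of_real t" h] h(2) \<rho>(2) by simp
    qed (simp add: star_add star_of_real h)
    have cont: "continuous_on ?I (\<lambda>t. cabs (?g t))"
    proof (rule continuous_on_compose2[OF continuous_on_cabs])
      show "continuous_on ?I ?g" by (intro continuous_intros)
      show "?g ` ?I \<subseteq> {h. star h = h \<and> norm h \<le> 1/2}" using g by blast
    qed
    define P where "P = {t \<in> ?I. f * (cabs (?g t) + ?g t) \<in> F}"
    define N where "N = {t \<in> ?I. f * (cabs (?g t) - ?g t) \<in> F}"
    have "continuous_on ?I (\<lambda>t. f * (cabs (?g t) + ?g t))"
      by (intro continuous_intros cont)
    from continuous_closed_preimage[OF this _ closed_F]
    have "closed P" by (simp add: P_def vimage_def Int_def)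
    have "continuous_on ?I (\<lambda>t. f * (cabs (?g t) - ?g t))"
      by (intro continuous_intros cont)
    from continuous_closed_preimage[OF this _ closed_F]
    have "closed N" by (simp add: N_def vimage_def Int_def)
    \<comment> \<open>Twice the positive part and twice the negative part of \<open>?g t\<close>
      have product \<open>0\<close>, so the atom \<open>f\<close> sends one of them into
      \<open>F\<close>.\<close>
    have "?I \<subseteq> P \<union> N"
    proof
      fix t assume t: "t \<in> ?I"
      let ?p = "cabs (?g t) + ?g t" and ?n = "cabs (?g t) - ?g t"
      have "?p * ?n = 0"
        using cabs_square[OF g[OF t]] cabs_commute[OF g[OF t]]
        by (simp add: ring_distribs power2_eq_square)
      then have "f * ?p * (?n * f) = 0" by (metis mult.assoc mult_zero_left mult_zero_right)
      moreover have "(f * ?p * (f * ?n)) \<rhd> D b = (f * ?p * (?n * f)) \<rhd> D b" for b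
        using lm_D_commute[of f ?n b] by (simp only: lm_mult[symmetric, of "f * ?p"])
      ultimately have "f * ?p * (f * ?n) \<in> F" by (simp add: F_def)
      then show "t \<in> P \<union> N" using atom t by (auto simp: P_def N_def)
    qed
    \<comment> \<open>At the endpoints \<open>?g t\<close> equals \<open>cabs (?g t)\<close> or its
      negative, so both sets are nonempty and connectedness of the interval gives a common
      \<open>t\<close>.\<close>
    have "1/4 \<in> N"
      using \<rho>(3)[OF h] ideal_zero[OF two_sided_ideal_F] by (simp add: N_def)
    have "cabs (?g (- 1/4)) = - ?g (- 1/4)"
      using \<rho>(3)[of "- h"] h cabs_minus[of "?g (- 1/4)"] by (simp add: star_minus)
    then have "- 1/4 \<in> P"
      using ideal_zero[OF two_sided_ideal_F] by (simp add: P_def)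
    have "P \<inter> N \<noteq> {}"
    proof
      assume "P \<inter> N = {}"
      then have "P \<inter> ?I = {} \<or> N \<inter> ?I = {}"
        using \<open>?I \<subseteq> P \<union> N\<close> \<open>closed P\<close> \<open>closed N\<close>
        by (intro connected_closedD) auto
      then show False using \<open>1/4 \<in> N\<close> \<open>- 1/4 \<in> P\<close> by auto
    qed
    then obtain t where "f * (cabs (?g t) + ?g t) \<in> F" "f * (cabs (?g t) - ?g t) \<in> F"
      by (auto simp: P_def N_def)
    then have "(1/2) *\<^sub>R (f * (cabs (?g t) + ?g t) - f * (cabs (?g t) - ?g t)) \<in> F"
      by (intro ideal_scaleR ideal_diff two_sided_ideal_F)
    moreover have "f * (c + g) - f * (c - g) = 2 *\<^sub>R (f * g)" for c g
      by (simp add: ring_distribs scaleR_2)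
    ultimately have "f * ?g t \<in> F" by simp
    then show ?thesis by blast
  qed
  \<comment> \<open>Apply \<open>D\<close> to the product and then act by \<open>f\<close>: the term
    with \<open>D f\<close> vanishes, as its coefficient lies in \<open>F\<close>.\<close>
  moreover have "(f * f) \<rhd> D h = 0" if "f * (of_real t + h) \<in> F" for t h
  proof -
    have "D (f * (of_real t + h)) = 0"
      using that by (intro D_zero_on_F ideal_mult_right[OF ideal_A f(1)])
    then have "f \<rhd> (f \<rhd> D h + (of_real t + h) \<rhd> D f) = 0"
      by (simp add: D_mult D_add)
    then have "(f * f) \<rhd> D h + (f * (of_real t + h)) \<rhd> D f = 0"
      by (simp only: lm_add_right lm_mult)
    then show ?thesis using that by (simp add: F_def)
  qed
  ultimately have "f * f \<in> F"
    using memF_if_small_selfadjoint[OF \<rho>(1)] by blast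
  then show False using F_semiprime f by blast
qed

corollary D_zero_on_A: "a \<in> A \<Longrightarrow> D a = 0"
  using A_subset_F D_zero_on_F by blast

end

lemma (in jordan_derivation) defect_eq_zero:
  assumes "b \<in> A"
  shows "defect a b = 0"
proof -
  interpret symmetric_derivation star A ii lm "defect a"
    by (intro symmetric_derivation.intro cstar_ideal_axioms normed_left_module_axioms
        symmetric_derivation_axioms.intro)
      (rule defect_add_right defect_scaleR_right defect_ii_right defect_derivation
        lm_defect_commute bounded_linear_lm_defect)+
  show ?thesis by (rule D_zero_on_A[OF assms])
qed

subsection \<open>Unitization\<close>

lemma scaleC_zero_left [simp]: "scaleC 0 (x::'a::complex_vector) = 0"
  using scaleC_add_left[of 0 0 x] by simp

lemma scaleC_zero_right [simp]: "scaleC c (0::'a::complex_vector) = 0"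
  using scaleC_add_right[of c 0 "0::'a"] by simp

datatype 'a unitization = Unitization (alg_part: 'a) (scalar_part: complex)

instantiation unitization :: (complex_normed_algebra) real_algebra_1
begin

definition "0 = Unitization 0 0"
definition "1 = Unitization 0 1"
definition "x + y = Unitization (alg_part x + alg_part y) (scalar_part x + scalar_part y)"
definition "x - y = Unitization (alg_part x - alg_part y) (scalar_part x - scalar_part y)"
definition "- x = Unitization (- alg_part x) (- scalar_part x)"
definition "r *\<^sub>R x = Unitization (r *\<^sub>R alg_part x) (r *\<^sub>R scalar_part x)"
definition "x * y = Unitization
  (alg_part x * alg_part y + scaleC (scalar_part x) (alg_part y) + scaleC (scalar_part y) (alg_part x))
  (scalar_part x * scalar_part y)"
lemmas unitization_defs = zero_unitization_def one_unitization_def plus_unitization_def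
  minus_unitization_def uminus_unitization_def scaleR_unitization_def times_unitization_def

instance
proof
  fix x y z :: "'a unitization" and a b :: real
  show "x + y + z = x + (y + z)" "x + y = y + x" "0 + x = x" "- x + x = 0" "x - y = x + - y"
    by (simp_all add: unitization_defs add_ac)
  show "a *\<^sub>R (x + y) = a *\<^sub>R x + a *\<^sub>R y" "(a + b) *\<^sub>R x = a *\<^sub>R x + b *\<^sub>R x"
    "a *\<^sub>R b *\<^sub>R x = (a * b) *\<^sub>R x" "1 *\<^sub>R x = x"
    by (simp_all add: unitization_defs scaleR_add_right scaleR_add_left)
  show "x * y * z = x * (y * z)"
    by (simp add: unitization_defs distrib_left distrib_right scaleC_add_right mult_scaleC_left
        mult_scaleC_right scaleC_scaleC mult_ac add_ac mult.assoc)
  show "1 * x = x" "x * 1 = x"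
    by (simp_all add: unitization_defs scaleC_one)
  show "(x + y) * z = x * z + y * z" "x * (y + z) = x * y + x * z"
    by (simp_all add: unitization_defs distrib_left distrib_right scaleC_add_left scaleC_add_right add_ac)
  show "(0 :: 'a unitization) \<noteq> 1" by (simp add: unitization_defs)
  show "a *\<^sub>R x * y = a *\<^sub>R (x * y)" "x * a *\<^sub>R y = a *\<^sub>R (x * y)"
    by (simp_all add: unitization_defs scaleR_scaleC scaleC_add_right scaleC_scaleC mult_scaleC_left
        mult_scaleC_right scaleR_conv_of_real mult_ac)
qed

end

instantiation unitization :: (complex_normed_algebra) real_normed_algebra_1
begin

definition "norm x = norm (alg_part x) + cmod (scalar_part x)"
definition "dist x y = norm (x - y)" for x y :: "'a unitization"
definition "sgn x = x /\<^sub>R norm x" for x :: "'a unitization"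
definition [code del]:
  "uniformity = (INF e\<in>{0 <..}. principal {(x, y :: 'a unitization). dist x y < e})"
definition [code del]:
  "open U \<longleftrightarrow> (\<forall>x\<in>U. eventually (\<lambda>(x', y). x' = x \<longrightarrow> y \<in> U) uniformity)"
  for U :: "'a unitization set"

instance
proof
  fix x y :: "'a unitization" and a :: real
  show "dist x y = norm (x - y)" by (rule dist_unitization_def)
  show "sgn x = x /\<^sub>R norm x" by (rule sgn_unitization_def)
  show "uniformity = (INF e\<in>{0 <..}. principal {(x, y :: 'a unitization). dist x y < e})"
    by (rule uniformity_unitization_def)
  show "open U \<longleftrightarrow> (\<forall>x\<in>U. eventually (\<lambda>(x', y). x' = x \<longrightarrow> y \<in> U) uniformity)"
    for U :: "'a unitization set" by (rule open_unitization_def)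
  show "norm x = 0 \<longleftrightarrow> x = 0"
    by (cases x) (auto simp: norm_unitization_def unitization_defs add_nonneg_eq_0_iff)
  show "norm (x + y) \<le> norm x + norm y"
    using norm_triangle_ineq[of "alg_part x" "alg_part y"]
      norm_triangle_ineq[of "scalar_part x" "scalar_part y"]
    by (simp add: norm_unitization_def unitization_defs)
  show "norm (a *\<^sub>R x) = \<bar>a\<bar> * norm x"
    by (simp add: norm_unitization_def unitization_defs distrib_left)
  show "norm (1 :: 'a unitization) = 1"
    by (simp add: norm_unitization_def unitization_defs)
  show "norm (x * y) \<le> norm x * norm y"
  proof -
    let ?a = "alg_part x" and ?b = "alg_part y" and ?l = "scalar_part x" and ?m = "scalar_part y"
    have "norm (?a * ?b + scaleC ?l ?b + scaleC ?m ?a)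
        \<le> norm (?a * ?b) + norm (scaleC ?l ?b) + norm (scaleC ?m ?a)"
      by (intro norm_triangle_le add_mono) auto
    also have "\<dots> \<le> norm ?a * norm ?b + cmod ?l * norm ?b + cmod ?m * norm ?a"
      by (simp add: norm_scaleC norm_mult_ineq)
    finally show ?thesis
      by (simp add: norm_unitization_def times_unitization_def norm_mult algebra_simps)
  qed
qed

end

lemma alg_part_simps [simp]:
  "alg_part 0 = 0" "alg_part 1 = 0" "alg_part (x + y) = alg_part x + alg_part y"
  "alg_part (x - y) = alg_part x - alg_part y" "alg_part (- x) = - alg_part x"
  "alg_part (r *\<^sub>R x) = r *\<^sub>R alg_part x"
  "alg_part (x * y) = alg_part x * alg_part y + scaleC (scalar_part x) (alg_part y)
    + scaleC (scalar_part y) (alg_part x)"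
  by (simp_all add: unitization_defs)

lemma scalar_part_simps [simp]:
  "scalar_part 0 = 0" "scalar_part 1 = 1" "scalar_part (x + y) = scalar_part x + scalar_part y"
  "scalar_part (x - y) = scalar_part x - scalar_part y" "scalar_part (- x) = - scalar_part x"
  "scalar_part (r *\<^sub>R x) = r *\<^sub>R scalar_part x"
  "scalar_part (x * y) = scalar_part x * scalar_part y"
  by (simp_all add: unitization_defs)

lemma bounded_linear_alg_part: "bounded_linear alg_part"
  by (rule bounded_linear_intro[of _ 1]) (auto simp: norm_unitization_def)

lemma bounded_linear_scalar_part: "bounded_linear scalar_part"
  by (rule bounded_linear_intro[of _ 1]) (auto simp: norm_unitization_def)

instance unitization :: ("{complex_normed_algebra,banach}") banach
proof
  fix X :: "nat \<Rightarrow> 'a unitization" assume "Cauchy X"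
  then have "Cauchy (\<lambda>n. alg_part (X n))" "Cauchy (\<lambda>n. scalar_part (X n))"
    by (rule bounded_linear.Cauchy[OF bounded_linear_alg_part]
        bounded_linear.Cauchy[OF bounded_linear_scalar_part])+
  then obtain a l where "(\<lambda>n. alg_part (X n)) \<longlonglongrightarrow> a" "(\<lambda>n. scalar_part (X n)) \<longlonglongrightarrow> l"
    by (auto simp: Cauchy_convergent_iff convergent_def)
  then have "(\<lambda>n. norm (alg_part (X n) - a) + norm (scalar_part (X n) - l)) \<longlonglongrightarrow> 0"
    by (intro tendsto_add_zero) (auto simp: LIM_zero tendsto_norm_zero)
  then have "(\<lambda>n. norm (X n - Unitization a l)) \<longlonglongrightarrow> 0"
    by (simp add: norm_unitization_def)
  then have "X \<longlonglongrightarrow> Unitization a l"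
    by (simp add: tendsto_norm_zero_iff LIM_zero_iff)
  then show "convergent X" by (auto simp: convergent_def)
qed

lemma invol_zero [simp]: "invol (0::'a::cstar_algebra) = 0"
  using invol_add[of 0 "0::'a"] by simp

lemma invol_scaleR: "invol (r *\<^sub>R x) = r *\<^sub>R invol (x::'a::cstar_algebra)"
  by (simp add: scaleR_scaleC invol_scaleC)

lemma norm_invol_le: "norm x \<le> norm (invol (x::'a::cstar_algebra))"
proof (cases "x = 0")
  case False
  have "(norm x)\<^sup>2 \<le> norm (invol x) * norm x"
    unfolding cstar_identity[symmetric] by (rule norm_mult_ineq)
  with False show ?thesis by (simp add: power2_eq_square)
qed simp

lemma norm_invol: "norm (invol x) = norm (x::'a::cstar_algebra)"
  using norm_invol_le[of x] norm_invol_le[of "invol x"] by (simp add: invol_invol)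

definition unitization_star :: "'a::cstar_algebra unitization \<Rightarrow> 'a unitization" where
  "unitization_star x = Unitization (invol (alg_part x)) (cnj (scalar_part x))"

lemma unitization_star_simps [simp]:
  "alg_part (unitization_star x) = invol (alg_part x)"
  "scalar_part (unitization_star x) = cnj (scalar_part x)"
  by (simp_all add: unitization_star_def)

text \<open>The bound \<open>3\<close> arises thus: for an isometry \<open>u\<close> with parts
  \<open>a\<close> and \<open>l\<close>, \<open>cmod l = 1\<close>, and the C*-identity in the
  algebra yields that the square of \<open>norm a\<close> is at most
  \<open>2 * norm a\<close>.\<close>

lemma cstar_ideal_unitization:
  "cstar_ideal (unitization_star :: 'a::cstar_algebra unitization \<Rightarrow> _) {x. scalar_part x = 0}
    (Unitization 0 \<i>)"
proof
  let ?star = "unitization_star :: 'a unitization \<Rightarrow> _"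
  let ?A = "{x :: 'a unitization. scalar_part x = 0}"
  fix x y u :: "'a unitization"
  show "?star (x + y) = ?star x + ?star y" for x y
    by (rule unitization.expand) (simp add: invol_add)
  show "?star (r *\<^sub>R x) = r *\<^sub>R ?star x" for r x
    by (rule unitization.expand) (simp add: invol_scaleR)
  show "\<exists>K. \<forall>x. norm (?star x) \<le> norm x * K"
    by (rule exI[of _ 1]) (simp add: norm_unitization_def norm_invol)
  show "?star (x * y) = ?star y * ?star x"
    by (rule unitization.expand) (simp add: invol_add invol_mult invol_scaleC mult.commute add_ac)
  show "?star (?star x) = x"
    by (rule unitization.expand) (simp add: invol_invol)
  show "closed ?A"
    by (intro closed_Collect_eq linear_continuous_on bounded_linear_scalar_part continuous_on_const)
  show "two_sided_ideal ?A" by (rule two_sided_idealI) auto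
  show "?star x \<in> ?A" if "x \<in> ?A" using that by simp
  show "x * y - y * x \<in> ?A" by (simp add: mult.commute)
  show "norm (x * ?star x) = (norm x)\<^sup>2" if "x \<in> ?A"
    using that cstar_identity[of "invol (alg_part x)"]
    by (simp add: norm_unitization_def invol_invol norm_invol)
  show "norm u \<le> 3" if "?star u * u = 1"
  proof -
    let ?a = "alg_part u" and ?l = "scalar_part u"
    have eqs: "invol ?a * ?a + scaleC (cnj ?l) ?a + scaleC ?l (invol ?a) = 0" "cnj ?l * ?l = 1"
      using arg_cong[OF that, of alg_part] arg_cong[OF that, of scalar_part] by simp_all
    have l: "cmod ?l = 1"
      using arg_cong[OF eqs(2), of cmod] by (simp add: norm_mult flip: power2_eq_square)
        (smt (verit) norm_ge_zero power2_eq_1_iff)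
    have "invol ?a * ?a = - (scaleC (cnj ?l) ?a + scaleC ?l (invol ?a))"
      using eqs(1) by (simp only: eq_neg_iff_add_eq_0 add.assoc)
    then have "(norm ?a)\<^sup>2 = norm (scaleC (cnj ?l) ?a + scaleC ?l (invol ?a))"
      by (metis cstar_identity norm_minus_cancel)
    also have "\<dots> \<le> 2 * norm ?a"
      by (rule norm_triangle_le) (simp add: norm_scaleC l norm_invol)
    finally have "norm ?a \<le> 2"
      by (cases "norm ?a = 0") (auto simp: power2_eq_square)
    then show ?thesis by (simp add: norm_unitization_def l)
  qed
  show "Unitization 0 \<i> * Unitization 0 \<i> = (- 1 :: 'a unitization)"
    "Unitization 0 \<i> * x = x * Unitization 0 \<i>"
    "?star (Unitization 0 \<i>) = - Unitization 0 \<i>"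
    by (rule unitization.expand; simp)+
qed

section \<open>Transfer from the unitization\<close>

theorem theorem3p3:
  fixes \<phi> :: "'a::cstar_algebra \<Rightarrow> 'b::{complex_normed_algebra,banach}"
    and \<psi> :: "'a \<Rightarrow> 'c::{complex_normed_algebra,banach}"
    and lact :: "'b \<Rightarrow> 'x::{complex_normed_vector,banach} \<Rightarrow> 'x"
    and ract :: "'x \<Rightarrow> 'c \<Rightarrow> 'x"
    and \<delta> :: "'a \<Rightarrow> 'x"
  assumes "alg_hom \<phi>" and "alg_hom \<psi>"
    and "banach_bimodule lact ract"
    and "bounded_map \<delta>"
    and "jordan_phipsi_derivation \<phi> \<psi> lact ract \<delta>"
  shows "phipsi_derivation \<phi> \<psi> lact ract \<delta>"
proof -
  have \<phi>: "\<phi> (x + y) = \<phi> x + \<phi> y" "\<phi> (scaleC c x) = scaleC c (\<phi> x)" "\<phi> (x * y) = \<phi> x * \<phi> y" for x y c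
    using assms(1) by (auto simp: alg_hom_def clinear_def)
  have \<psi>: "\<psi> (x + y) = \<psi> x + \<psi> y" "\<psi> (scaleC c x) = scaleC c (\<psi> x)" "\<psi> (x * y) = \<psi> x * \<psi> y" for x y c
    using assms(2) by (auto simp: alg_hom_def clinear_def)
  have lact: "lact b (x + y) = lact b x + lact b y" "lact (b + b') x = lact b x + lact b' x"
    "lact (b * b') x = lact b (lact b' x)" "lact (scaleC c b) x = scaleC c (lact b x)"
    "lact b (scaleC c x) = scaleC c (lact b x)" "norm (lact b x) \<le> norm b * norm x" for b b' x y c
    using assms(3) unfolding banach_bimodule_def by simp_all
  have ract: "ract (x + y) b = ract x b + ract y b" "ract x (b + b') = ract x b + ract x b'"
    "ract x (b * b') = ract (ract x b) b'" "ract x (scaleC c b) = scaleC c (ract x b)"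
    "ract (scaleC c x) b = scaleC c (ract x b)" "norm (ract x b) \<le> norm x * norm b" for b b' x y c
    using assms(3) unfolding banach_bimodule_def by simp_all
  have lract: "ract (lact b x) c = lact b (ract x c)" for b x c
    using assms(3) unfolding banach_bimodule_def by blast
  have \<delta>: "\<delta> (x + y) = \<delta> x + \<delta> y" "\<delta> (scaleC c x) = scaleC c (\<delta> x)"
    "\<delta> (x * x) = lact (\<phi> x) (\<delta> x) + ract (\<delta> x) (\<psi> x)" for x y c
    using assms(5) by (auto simp: jordan_phipsi_derivation_def clinear_def)
  obtain K where K: "\<And>x. norm (\<delta> x) \<le> K * norm x"
    using assms(4) by (auto simp: bounded_map_def)
  \<comment> \<open>Scalars act by scalar multiplication, and \<open>\<delta>'\<close> sends the
    adjoined unit to \<open>0\<close>, as the Jordan identity at \<open>1\<close> forces.\<close>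
  define lm where "lm u x = lact (\<phi> (alg_part u)) x + scaleC (scalar_part u) x" for u x
  define rm where "rm x u = ract x (\<psi> (alg_part u)) + scaleC (scalar_part u) x" for u x
  define \<delta>' where "\<delta>' u = \<delta> (alg_part u)" for u
  have zero: "\<phi> 0 = 0" "\<psi> 0 = 0" "lact 0 x = 0" "ract x 0 = 0" "\<delta> 0 = 0" for x
    using \<phi>(2)[of 0 0] \<psi>(2)[of 0 0] lact(4)[of 0 0 x] ract(4)[of x 0 0] \<delta>(2)[of 0 0] by simp_all
  note simps = lm_def rm_def \<delta>'_def \<phi> \<psi> lact(1-5) ract(1-5) lract \<delta>(1,2) zero
    scaleC_add_left scaleC_add_right scaleC_scaleC scaleC_one
  interpret jordan_derivation unitization_star "{x. scalar_part x = 0}" "Unitization 0 \<i>" lm rm \<delta>'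
  proof (intro jordan_derivation.intro cstar_ideal_unitization normed_left_module.intro
      jordan_derivation_axioms.intro)
    fix a b u :: "'a unitization" and x :: 'x and r :: real
    show "lm (a + b) x = lm a x + lm b x" "lm a (lm b x) = lm (a * b) x"
      "lm 1 x = x" "rm x (a + b) = rm x a + rm x b" "rm (rm x a) b = rm x (a * b)" "rm x 1 = x"
      "rm (lm a x) b = lm a (rm x b)" "lm (Unitization 0 \<i>) x = rm x (Unitization 0 \<i>)"
      by (simp_all add: simps add_ac mult.commute)
    show "lm (r *\<^sub>R a) x = r *\<^sub>R lm a x" "rm x (r *\<^sub>R a) = r *\<^sub>R rm x a"
      by (simp_all add: simps scaleR_scaleC scaleR_conv_of_real[where 'a=complex])
    show "bounded_linear (\<lambda>x. lm a x)"
    proof (rule bounded_linear_intro)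
      show "norm (lm a x) \<le> norm x * (norm (\<phi> (alg_part a)) + cmod (scalar_part a))" for x
        unfolding lm_def
        using norm_triangle_ineq[of "lact (\<phi> (alg_part a)) x" "scaleC (scalar_part a) x"]
          lact(6)[of "\<phi> (alg_part a)" x] by (simp add: norm_scaleC algebra_simps)
    qed (simp_all add: simps scaleR_scaleC add_ac mult.commute)
    show "bounded_linear (\<lambda>x. rm x a)"
    proof (rule bounded_linear_intro)
      show "norm (rm x a) \<le> norm x * (norm (\<psi> (alg_part a)) + cmod (scalar_part a))" for x
        unfolding rm_def
        using norm_triangle_ineq[of "ract x (\<psi> (alg_part a))" "scaleC (scalar_part a) x"]
          ract(6)[of x "\<psi> (alg_part a)"] by (simp add: norm_scaleC algebra_simps)
    qed (simp_all add: simps scaleR_scaleC add_ac mult.commute)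
    show "bounded_linear \<delta>'"
      unfolding \<delta>'_def
    proof (rule bounded_linear_compose[OF _ bounded_linear_alg_part])
      show "bounded_linear \<delta>"
        by (rule bounded_linear_intro[of _ K]) (auto simp: \<delta> scaleR_scaleC K mult.commute)
    qed
    show "\<delta>' (a * a) = lm a (\<delta>' a) + rm (\<delta>' a) a"
      by (simp add: simps \<delta>(3) add_ac)
  qed
  \<comment> \<open>On elements with scalar part \<open>0\<close> the extended actions and
    \<open>\<delta>'\<close> reduce to the original data, so the vanishing defect is the
    claim.\<close>
  have "\<delta> (a * b) = ract (\<delta> a) (\<psi> b) + lact (\<phi> a) (\<delta> b)" for a b
    using defect_eq_zero[of "Unitization b 0" "Unitization a 0"]
    unfolding defect_def by (simp add: lm_def rm_def \<delta>'_def algebra_simps)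
  then show ?thesis
    using assms(5) by (simp add: phipsi_derivation_def jordan_phipsi_derivation_def)
qed

end
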